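(* Let $T$ be a tournament on $n$ vertices with out-degree sequence $d_1^+,\dots,d_n^+$. Then $$\mathrm{allarb}(T)\geq \frac{1}{n}\left(\prod_{k=1}^n(d^+_k+1)+\prod_{k=1}^n d^+_k\right).$$ Equality holds if and only if $T$ is a locally transitive tournament.
   Context: A tournament on $n$ vertices is an orientation of the complete graph $K_n$. An arborescence of a directed graph $D$ rooted at a vertex $v$ is a spanning tree of $D$ (a set of directed edges whose underlying undirected graph is a spanning tree) in which every vertex different from $v$ has out-degree $1$ and $v$ has out-degree $0$; that is, every edge is oriented towards the root. $\mathrm{arb}(D,v)$ is the number of arborescences of $D$ rooted at $v$, and $\mathrm{allarb}(D)=\sum_{v\in V}\mathrm{arb}(D,v)$. A digraph is locally transitive if for every vertex $v$ the out-neighbors $N^+(v)$ and the in-neighbors $N^-(v)$ both induce a transitive tournament (a tournament with no directed cycle). *)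

theory Defs
  imports Complex_Main "Graph_Theory.Digraph_Component"
begin

definition tournament :: "('a, 'b) pre_digraph \<Rightarrow> bool" where
  "tournament D \<longleftrightarrow> digraph D \<and>
     (\<forall>u \<in> verts D. \<forall>v \<in> verts D. u \<noteq> v \<longrightarrow> (u \<rightarrow>\<^bsub>D\<^esub> v \<longleftrightarrow> \<not> v \<rightarrow>\<^bsub>D\<^esub> u))"

(* The library predicate tree only excludes directed cycles, so the transitive triangle would be
   a tree.  Here the underlying undirected graph must be a tree.  In the symmetric digraph
   mk_symmetric H a single undirected edge u v gives the cycle u, v, u; the undirected cycles are
   the cycles of length at least 3.  Since mk_symmetric merges parallel and antiparallel arcs and
   keeps loops, the definition is meant for orientations of simple graphs. *)
definition underlying_tree :: "('a, 'b) pre_digraph \<Rightarrow> bool" where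
  "underlying_tree H \<longleftrightarrow>
     connected H \<and> \<not> (\<exists>p. pre_digraph.cycle (with_proj (mk_symmetric H)) p \<and> length p \<ge> 3)"

definition arborescence :: "('a, 'b) pre_digraph \<Rightarrow> 'a \<Rightarrow> 'b set \<Rightarrow> bool" where
  "arborescence D r A \<longleftrightarrow>
     r \<in> verts D \<and> A \<subseteq> arcs D \<and>
     underlying_tree (D\<lparr>arcs := A\<rparr>) \<and>
     out_degree (D\<lparr>arcs := A\<rparr>) r = 0 \<and>
     (\<forall>v \<in> verts D - {r}. out_degree (D\<lparr>arcs := A\<rparr>) v = 1)"

definition arb :: "('a, 'b) pre_digraph \<Rightarrow> 'a \<Rightarrow> nat" where
  "arb D r = card {A. arborescence D r A}"

definition allarb :: "('a, 'b) pre_digraph \<Rightarrow> nat" where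
  "allarb D = (\<Sum>v \<in> verts D. arb D v)"

definition out_neighbors :: "('a, 'b) pre_digraph \<Rightarrow> 'a \<Rightarrow> 'a set" where
  "out_neighbors D v = {u \<in> verts D. v \<rightarrow>\<^bsub>D\<^esub> u}"

definition in_neighbors :: "('a, 'b) pre_digraph \<Rightarrow> 'a \<Rightarrow> 'a set" where
  "in_neighbors D v = {u \<in> verts D. u \<rightarrow>\<^bsub>D\<^esub> v}"

(* The library predicate forest says that there is no directed cycle. *)
definition transitive_tournament :: "('a, 'b) pre_digraph \<Rightarrow> bool" where
  "transitive_tournament D \<longleftrightarrow> tournament D \<and> forest D"

definition locally_transitive :: "('a, 'b) pre_digraph \<Rightarrow> bool" where
  "locally_transitive D \<longleftrightarrow>
     (\<forall>v \<in> verts D. transitive_tournament (D \<restriction> out_neighbors D v) \<and>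
                    transitive_tournament (D \<restriction> in_neighbors D v))"

end

theory Submission
  imports Defs "HOL-Combinatorics.Permutations" "Jordan_Normal_Form.Determinant"
begin

text \<open>
  Let \<open>A\<close> be the adjacency matrix of a tournament on \<open>n\<close> vertices, \<open>D\<close> the diagonal matrix of the
  out-degrees \<open>d\<^sub>v\<close>, \<open>L = D - A\<close> the Laplacian and \<open>J\<close> the all-ones matrix.  Row \<open>v\<close> of \<open>L\<close> is the sum of \<open>e\<^sub>v - e\<^sub>w\<close> over
  the out-neighbours \<open>w\<close> of \<open>v\<close>, so the determinant of \<open>L\<close> with row \<open>r\<close> replaced by \<open>e\<^sub>r\<close> expands
  into a sum over the ways of choosing an out-neighbour for every \<open>v \<noteq> r\<close>.  A choice contributes
  \<open>1\<close> if all vertices are led to \<open>r\<close> and \<open>0\<close> otherwise; this is the matrix-tree theorem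
  (\<open>matrix_tree\<close>, with \<open>arb_eq_card_parents\<close> for the translation into arborescences).  Since the
  rows of \<open>L\<close> sum to zero, it yields \<open>det (L + x J) = x n allarb(T)\<close>.

  In a tournament \<open>J = I + A + A\<^sup>T\<close>, hence \<open>2 L + J = (2 D + I) + K\<close> with the skew-symmetric matrix
  \<open>K = A\<^sup>T - A\<close>, all of whose entries off the diagonal are \<open>\<plusminus>1\<close>.  Expanding along the diagonal part,
  \<open>2^(n - 1) * n * allarb(T) = (\<Sum>R. det K\<^sub>R * (\<Prod>v\<notin>R. 2 d\<^sub>v + 1))\<close>,
  where \<open>K\<^sub>R\<close> is the principal submatrix on the vertex set \<open>R\<close>.  For odd \<open>|R|\<close> the minor vanishes.
  For even \<open>|R|\<close> it is nonnegative (real skew-symmetric matrices have nonnegative determinant) and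
  odd (adding \<open>J\<close> leaves it unchanged and produces \<open>I + 2 A\<^sup>T\<close>), hence at least \<open>1\<close>
  (\<open>setdet_skew_adj_ge_1\<close>).  If all even minors are replaced by \<open>1\<close>, the sum over even \<open>R\<close> becomes
  \<open>1/2 (\<Prod>(2 d\<^sub>v + 2) + \<Prod>(2 d\<^sub>v))\<close>, which is the claimed bound.

  All weights \<open>2 d\<^sub>v + 1\<close> are positive, so equality holds iff every even principal minor of \<open>K\<close> is
  \<open>1\<close>.  A 3-cycle all of whose vertices dominate, or are dominated by, a further vertex spans
  together with it an even minor divisible by 3, so equality forces local transitivity.  Conversely, changing
  the signs of suitable rows and columns (reversing the arcs across a cut) turns a locally
  transitive tournament into a transitive one without changing the minor, and for a transitive
  tournament \<open>K + J\<close> is unitriangular.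
\<close>

section \<open>Determinants of matrices indexed by a finite set\<close>

text \<open>
  The determinant of the square matrix \<open>M\<close> whose rows and columns are indexed by \<open>V\<close>.  Indexing by a
  set makes principal minors available as \<open>setdet R M\<close> for \<open>R \<subseteq> V\<close>, without renumbering vertices.
\<close>

definition setdet :: "'a set \<Rightarrow> ('a \<Rightarrow> 'a \<Rightarrow> 'c::comm_ring_1) \<Rightarrow> 'c" where
  "setdet V M = (\<Sum>p | p permutes V. of_int (sign p) * (\<Prod>i\<in>V. M i (p i)))"

lemma setdet_cong:
  assumes "\<And>i j. i \<in> V \<Longrightarrow> j \<in> V \<Longrightarrow> M i j = N i j"
  shows "setdet V M = setdet V N"
  unfolding setdet_def
  by (intro sum.cong prod.cong arg_cong2[where f = "(*)"] refl assms)
     (auto simp: permutes_in_image)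

lemma setdet_transpose:
  assumes "finite V"
  shows "setdet V (\<lambda>i j. M j i) = setdet V M"
proof -
  have eq: "(\<Prod>i\<in>V. M (p i) i) = (\<Prod>i\<in>V. M i (Hilbert_Choice.inv p i))" if "p permutes V" for p
  proof -
    have "(\<Prod>i\<in>V. M i (Hilbert_Choice.inv p i)) = (\<Prod>i\<in>V. M (p i) (Hilbert_Choice.inv p (p i)))"
      using prod.permute[OF that, of "\<lambda>i. M i (Hilbert_Choice.inv p i)"] by (simp add: o_def)
    also have "\<dots> = (\<Prod>i\<in>V. M (p i) i)"
      using that by (simp add: permutes_inverses)
    finally show ?thesis by simp
  qed
  show ?thesis
    unfolding setdet_def
    by (rule sum.reindex_bij_witness[where i = Hilbert_Choice.inv and j = Hilbert_Choice.inv])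
       (auto simp: permutes_inv permutes_inv_inv eq sign_inverse permutes_imp_permutation[OF assms])
qed

lemma setdet_add_rows:
  assumes "finite V"
  shows "setdet V (\<lambda>i j. M i j + N i j)
       = (\<Sum>R\<in>Pow V. setdet V (\<lambda>i j. if i \<in> R then M i j else N i j))"
proof -
  have "(\<Prod>i\<in>V. M i (p i) + N i (p i))
      = (\<Sum>R\<in>Pow V. \<Prod>i\<in>V. if i \<in> R then M i (p i) else N i (p i))" for p
    unfolding prod_add[OF assms]
  proof (rule sum.cong[OF refl])
    fix R assume R: "R \<in> Pow V"
    have "(\<Prod>i\<in>V. if i \<in> R then M i (p i) else N i (p i))
        = (\<Prod>i\<in>R. if i \<in> R then M i (p i) else N i (p i))
        * (\<Prod>i\<in>V - R. if i \<in> R then M i (p i) else N i (p i))"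
      using R assms by (simp add: prod.subset_diff[of R V] mult.commute)
    then show "(\<Prod>i\<in>R. M i (p i)) * (\<Prod>i\<in>V - R. N i (p i))
        = (\<Prod>i\<in>V. if i \<in> R then M i (p i) else N i (p i))"
      by simp
  qed
  then show ?thesis
    unfolding setdet_def by (simp add: sum_distrib_left sum.swap[of _ "Pow V"])
qed

text \<open>
  Multilinearity with a family of summands for each row.  In the Laplacian the summands of a row
  are the arcs leaving a vertex, so the maps \<open>f\<close> choose one such arc per vertex.
\<close>

lemma setdet_sum_rows:
  assumes "finite V" "\<And>i. i \<in> V \<Longrightarrow> finite (F i)"
  shows "setdet V (\<lambda>i j. \<Sum>a\<in>F i. g i a j)
       = (\<Sum>f\<in>Pi\<^sub>E V F. setdet V (\<lambda>i j. g i (f i) j))"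
  unfolding setdet_def
  by (simp add: prod_sum_PiE[OF assms] sum_distrib_left sum.swap[of _ "Pi\<^sub>E V F"])

lemma setdet_row_sum:
  assumes "finite V" "c \<in> V"
  shows "setdet V (\<lambda>i j. if i = c then \<Sum>k\<in>S. g k j else M i j)
       = (\<Sum>k\<in>S. setdet V (\<lambda>i j. if i = c then g k j else M i j))"
  unfolding setdet_def
  by (simp add: prod.remove[OF assms] sum_distrib_left sum_distrib_right mult_ac
      sum.swap[of _ S] if_distrib cong: if_cong)

lemma setdet_scale_rows:
  assumes "finite V"
  shows "setdet V (\<lambda>i j. a i * M i j) = prod a V * setdet V M"
  unfolding setdet_def by (simp add: prod.distrib sum_distrib_left mult_ac)

lemma setdet_row_add:
  assumes "finite V" "c \<in> V"
  shows "setdet V (\<lambda>i j. if i = c then g j + h j else M i j)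
       = setdet V (\<lambda>i j. if i = c then g j else M i j)
       + setdet V (\<lambda>i j. if i = c then h j else M i j)"
  unfolding setdet_def
  by (simp add: prod.remove[OF assms] ring_distribs sum.distrib if_distrib cong: if_cong)

lemma setdet_scale_row:
  assumes "finite V" "c \<in> V"
  shows "setdet V (\<lambda>i j. if i = c then a * g j else M i j)
       = a * setdet V (\<lambda>i j. if i = c then g j else M i j)"
  unfolding setdet_def
  by (simp add: prod.remove[OF assms] sum_distrib_left mult_ac if_distrib cong: if_cong)

text \<open>
  Composing with the transposition of the two rows pairs off the permutations with opposite signs.
\<close>

lemma setdet_equal_rows:
  fixes M :: "'a \<Rightarrow> 'a \<Rightarrow> 'c::{idom,ring_char_0}"
  assumes V: "finite V" and ab: "a \<in> V" "b \<in> V" "a \<noteq> b"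
    and eq: "\<And>j. j \<in> V \<Longrightarrow> M a j = M b j"
  shows "setdet V M = 0"
proof -
  let ?t = "transpose a b"
  have t: "?t permutes V" using ab by (simp add: permutes_swap_id)
  have "setdet V M = (\<Sum>p | p permutes V. of_int (sign (p \<circ> ?t)) * (\<Prod>i\<in>V. M i ((p \<circ> ?t) i)))"
    unfolding setdet_def
    by (rule sum.reindex_bij_witness[where i = "\<lambda>p. p \<circ> ?t" and j = "\<lambda>p. p \<circ> ?t"])
       (auto simp: permutes_compose t o_assoc[symmetric])
  also have "\<dots> = (\<Sum>p | p permutes V. - (of_int (sign p) * (\<Prod>i\<in>V. M i (p i))))"
  proof (rule sum.cong[OF refl], clarify)
    fix p assume p: "p permutes V"
    have "sign (p \<circ> ?t) = - sign p"
      using ab p V by (simp add: sign_compose permutes_imp_permutation permutation_swap_id sign_swap_id)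
    moreover have "(\<Prod>i\<in>V. M i ((p \<circ> ?t) i)) = (\<Prod>i\<in>V. M i (p i))"
    proof -
      have "(\<Prod>i\<in>V. M i ((p \<circ> ?t) i)) = (\<Prod>i\<in>V. M (?t i) ((p \<circ> ?t) (?t i)))"
        using prod.permute[OF t, of "\<lambda>i. M i ((p \<circ> ?t) i)"] unfolding o_def .
      also have "\<dots> = (\<Prod>i\<in>V. M i (p i))"
      proof (rule prod.cong[OF refl])
        fix i assume "i \<in> V"
        then have "M (?t i) (p i) = M i (p i)"
          using p ab eq by (auto simp: transpose_def permutes_in_image)
        then show "M (?t i) ((p \<circ> ?t) (?t i)) = M i (p i)" by simp
      qed
      finally show ?thesis .
    qed
    ultimately show "of_int (sign (p \<circ> ?t)) * (\<Prod>i\<in>V. M i ((p \<circ> ?t) i))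
        = - (of_int (sign p) * (\<Prod>i\<in>V. M i (p i)))"
      by simp
  qed
  also have "\<dots> = - setdet V M" by (simp add: setdet_def sum_negf)
  finally show ?thesis by simp
qed

lemma setdet_row_combination:
  fixes M :: "'a \<Rightarrow> 'a \<Rightarrow> 'c::{idom,ring_char_0}"
  assumes V: "finite V" and c: "c \<in> V"
  shows "setdet V (\<lambda>i j. if i = c then \<Sum>k\<in>V. y k * M k j else M i j) = y c * setdet V M"
proof -
  have "setdet V (\<lambda>i j. if i = c then \<Sum>k\<in>V. y k * M k j else M i j)
      = (\<Sum>k\<in>V. y k * setdet V (\<lambda>i j. if i = c then M k j else M i j))"
    by (simp add: setdet_row_sum[OF V c] setdet_scale_row[OF V c])
  also have "\<dots> = y c * setdet V (\<lambda>i j. if i = c then M c j else M i j)"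
  proof -
    have "setdet V (\<lambda>i j. if i = c then M k j else M i j) = 0" if "k \<in> V - {c}" for k
      using that by (intro setdet_equal_rows[OF V c, of k]) auto
    then show ?thesis
      by (simp add: sum.remove[OF V c])
  qed
  also have "setdet V (\<lambda>i j. if i = c then M c j else M i j) = setdet V M"
    by (rule setdet_cong) auto
  finally show ?thesis .
qed

text \<open>
  Cramer's rule without division, so that it is available over the integers.
\<close>

lemma setdet_cramer:
  fixes M :: "'a \<Rightarrow> 'a \<Rightarrow> 'c::{idom,ring_char_0}"
  assumes V: "finite V" and c: "c \<in> V"
  shows "setdet V (\<lambda>i j. if j = c then \<Sum>k\<in>V. M i k * x k else M i j) = x c * setdet V M"
  using setdet_row_combination[OF V c, of x "\<lambda>i j. M j i"]
    setdet_transpose[OF V, of "\<lambda>i j. if j = c then \<Sum>k\<in>V. M i k * x k else M i j"]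
    setdet_transpose[OF V, of M]
  by (simp add: mult.commute cong: if_cong)

lemma setdet_zero_if_kernel:
  fixes M :: "'a \<Rightarrow> 'a \<Rightarrow> 'c::{idom,ring_char_0}"
  assumes V: "finite V" and c: "c \<in> V" "x c \<noteq> 0"
    and ker: "\<And>i. i \<in> V \<Longrightarrow> (\<Sum>k\<in>V. M i k * x k) = 0"
  shows "setdet V M = 0"
proof -
  have "x c * setdet V M = setdet V (\<lambda>i j. if j = c then 0 else M i j)"
    unfolding setdet_cramer[OF V c(1), symmetric] by (rule setdet_cong) (simp add: ker)
  also have "\<dots> = setdet V (\<lambda>i j. if i = c then 0 else M j i)"
    using setdet_transpose[OF V, of "\<lambda>i j. if j = c then 0 else M i j"] by simp
  also have "\<dots> = 0"
    using setdet_scale_row[OF V c(1), of 0 "\<lambda>_. 0" "\<lambda>i j. M j i"] by (simp cong: if_cong)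
  finally show ?thesis using c by simp
qed

lemma setdet_of_int: "setdet V (\<lambda>i j. of_int (M i j)) = of_int (setdet V M)"
  by (simp add: setdet_def)

text \<open>
  Adding a multiple of the all-ones matrix is a perturbation of rank one, so the determinant is an affine
  function of \<open>x\<close>: after multilinear expansion, two rows taken from the all-ones matrix coincide.
\<close>

lemma setdet_mat_add_const:
  fixes M :: "'a \<Rightarrow> 'a \<Rightarrow> 'c::{idom,ring_char_0}"
  assumes V: "finite V"
  shows "setdet V (\<lambda>i j. M i j + x) = setdet V M + x * (\<Sum>r\<in>V. setdet V (\<lambda>i j. if i = r then 1 else M i j))"
proof -
  let ?S = "\<lambda>R. setdet V (\<lambda>i j. if i \<in> R then x else M i j)"
  have "setdet V (\<lambda>i j. M i j + x) = (\<Sum>R\<in>Pow V. ?S R)"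
    using setdet_add_rows[OF V, of "\<lambda>_ _. x" M] by (simp add: add.commute)
  \<comment> \<open>Two rows of the constant \<open>x\<close> coincide, so only the sets \<open>R\<close> with at most one element survive.\<close>
  also have "\<dots> = (\<Sum>R\<in>insert {} ((\<lambda>r. {r}) ` V). ?S R)"
  proof (rule sum.mono_neutral_right)
    show "\<forall>R\<in>Pow V - insert {} ((\<lambda>r. {r}) ` V). ?S R = 0"
    proof
      fix R assume R: "R \<in> Pow V - insert {} ((\<lambda>r. {r}) ` V)"
      then obtain a where a: "a \<in> R" by auto
      with R have "R \<noteq> {a}" by auto
      with a obtain b where "b \<in> R" "b \<noteq> a" by auto
      with a R show "?S R = 0" by (intro setdet_equal_rows[OF V, of a b]) auto
    qed
  qed (use V in auto)
  also have "\<dots> = setdet V M + (\<Sum>r\<in>V. ?S {r})"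
    using V by (subst sum.insert) (auto simp: sum.reindex)
  also have "(\<Sum>r\<in>V. ?S {r}) = x * (\<Sum>r\<in>V. setdet V (\<lambda>i j. if i = r then 1 else M i j))"
    unfolding sum_distrib_left
    using setdet_scale_row[OF V, of _ x "\<lambda>_. 1" M] by (simp cong: if_cong)
  finally show ?thesis .
qed

text \<open>
  The permutations that contribute fix every index outside \<open>R\<close>.
\<close>

lemma setdet_diagonal_outside:
  assumes V: "finite V" and R: "R \<subseteq> V"
  shows "setdet V (\<lambda>i j. if i \<in> R then M i j else if i = j then x i else 0)
       = prod x (V - R) * setdet R M"
proof -
  let ?N = "\<lambda>i j. if i \<in> R then M i j else if i = j then x i else 0"
  have "setdet V ?N = (\<Sum>p | p permutes R. of_int (sign p) * (\<Prod>i\<in>V. ?N i (p i)))"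
    unfolding setdet_def
  proof (rule sum.mono_neutral_right)
    show "finite {p. p permutes V}" using V by (rule finite_permutations)
    show "{p. p permutes R} \<subseteq> {p. p permutes V}" using R by (auto intro: permutes_subset)
    show "\<forall>p\<in>{p. p permutes V} - {p. p permutes R}. of_int (sign p) * (\<Prod>i\<in>V. ?N i (p i)) = 0"
    proof
      fix p assume p: "p \<in> {p. p permutes V} - {p. p permutes R}"
      then obtain i where "i \<in> V - R" "p i \<noteq> i" by (auto intro: permutes_superset)
      then have "(\<Prod>i\<in>V. ?N i (p i)) = 0" using V by (intro prod_zero) auto
      then show "of_int (sign p) * (\<Prod>i\<in>V. ?N i (p i)) = 0" by simp
    qed
  qed
  also have "\<dots> = (\<Sum>p | p permutes R. prod x (V - R) * (of_int (sign p) * (\<Prod>i\<in>R. M i (p i))))"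
  proof (rule sum.cong[OF refl], clarify)
    fix p assume p: "p permutes R"
    have "(\<Prod>i\<in>V. ?N i (p i)) = (\<Prod>i\<in>V - R. ?N i (p i)) * (\<Prod>i\<in>R. ?N i (p i))"
      using V R by (rule prod.subset_diff[rotated])
    also have "(\<Prod>i\<in>V - R. ?N i (p i)) = prod x (V - R)"
      by (rule prod.cong) (auto simp: permutes_not_in[OF p])
    finally show "of_int (sign p) * (\<Prod>i\<in>V. ?N i (p i))
        = prod x (V - R) * (of_int (sign p) * (\<Prod>i\<in>R. M i (p i)))" by simp
  qed
  finally show ?thesis by (simp add: setdet_def sum_distrib_left)
qed

lemma setdet_add_diagonal:
  assumes V: "finite V"
  shows "setdet V (\<lambda>i j. M i j + (if i = j then x i else 0))
       = (\<Sum>R\<in>Pow V. prod x (V - R) * setdet R M)"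
  unfolding setdet_add_rows[OF V]
  by (rule sum.cong[OF refl]) (simp add: setdet_diagonal_outside[OF V])

text \<open>
  Otherwise take a minimal moved point: its image is smaller and hence fixed, which contradicts injectivity.
\<close>

lemma permutes_eq_id_if_wf:
  assumes p: "p permutes V" and wf: "wf r"
    and step: "\<And>i. i \<in> V \<Longrightarrow> p i \<noteq> i \<Longrightarrow> (p i, i) \<in> r"
  shows "p = id"
proof (rule ccontr)
  assume "p \<noteq> id"
  then obtain i0 where "i0 \<in> {i. p i \<noteq> i}" by (auto simp: fun_eq_iff)
  from wfE_min[OF wf this] obtain m
    where m: "p m \<noteq> m" and min: "\<And>y. (y, m) \<in> r \<Longrightarrow> p y = y" by auto
  have "m \<in> V" using m p by (auto simp: permutes_def)
  then have "p (p m) = p m" using step m min by blast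
  then show False using m permutes_inj[OF p] by (auto dest: injD)
qed

lemma setdet_unitriangular:
  assumes V: "finite V" and wf: "wf r"
    and diag: "\<And>i. i \<in> V \<Longrightarrow> M i i = 1"
    and off: "\<And>i j. i \<in> V \<Longrightarrow> j \<in> V \<Longrightarrow> i \<noteq> j \<Longrightarrow> (j, i) \<notin> r \<Longrightarrow> M i j = 0"
  shows "setdet V M = 1"
proof -
  have "setdet V M = (\<Sum>p\<in>{id}. of_int (sign p) * (\<Prod>i\<in>V. M i (p i)))"
    unfolding setdet_def
  proof (rule sum.mono_neutral_right)
    show "\<forall>p\<in>{p. p permutes V} - {id}. of_int (sign p) * (\<Prod>i\<in>V. M i (p i)) = 0"
    proof
      fix p assume p: "p \<in> {p. p permutes V} - {id}"
      then obtain i where "i \<in> V" "p i \<noteq> i" "(p i, i) \<notin> r"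
        using permutes_eq_id_if_wf[OF _ wf] by blast
      moreover have "p i \<in> V" using p \<open>i \<in> V\<close> by (auto simp: permutes_in_image)
      ultimately have "(\<Prod>i\<in>V. M i (p i)) = 0" using V off by (intro prod_zero) fastforce+
      then show "of_int (sign p) * (\<Prod>i\<in>V. M i (p i)) = 0" by simp
    qed
  qed (use V finite_permutations permutes_id in auto)
  also have "\<dots> = 1" by (simp add: diag)
  finally show ?thesis .
qed

lemma setdet_empty [simp]: "setdet {} M = 1"
  by (simp add: setdet_def)

lemma setdet_scale:
  assumes "finite V"
  shows "setdet V (\<lambda>i j. a * M i j) = a ^ card V * setdet V M"
  using setdet_scale_rows[OF assms, of "\<lambda>_. a" M] by simp

lemma setdet_scale_columns:
  assumes "finite V"
  shows "setdet V (\<lambda>i j. a j * M i j) = prod a V * setdet V M"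
  using setdet_scale_rows[OF assms, of a "\<lambda>i j. M j i"]
    setdet_transpose[OF assms, of M] setdet_transpose[OF assms, of "\<lambda>i j. a j * M i j"]
  by simp

section \<open>Skew-symmetric matrices\<close>

lemma setdet_skew_odd:
  fixes K :: "'a \<Rightarrow> 'a \<Rightarrow> 'c::{idom,ring_char_0}"
  assumes V: "finite V" and skew: "\<And>i j. K j i = - K i j" and "odd (card V)"
  shows "setdet V K = 0"
proof -
  have "setdet V K = setdet V (\<lambda>i j. (-1) * K i j)"
    unfolding setdet_transpose[OF V, of K, symmetric]
  proof (rule setdet_cong)
    fix i j show "K j i = - 1 * K i j" using skew[of j i] by simp
  qed
  also have "\<dots> = - setdet V K"
    unfolding setdet_scale[OF V] using assms(3) by simp
  finally show ?thesis by simp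
qed

text \<open>
  By \<open>setdet_mat_add_const\<close> the determinant is affine in \<open>x\<close>; by transposition it is an even function
  of \<open>x\<close>; hence it is constant.
\<close>

lemma setdet_skew_even_add_const:
  fixes K :: "'a \<Rightarrow> 'a \<Rightarrow> 'c::{idom,ring_char_0}"
  assumes V: "finite V" and skew: "\<And>i j. K j i = - K i j" and ev: "even (card V)"
  shows "setdet V (\<lambda>i j. K i j + x) = setdet V K"
proof -
  define c where "c = (\<Sum>r\<in>V. setdet V (\<lambda>i j. if i = r then 1 else K i j))"
  have lin: "setdet V (\<lambda>i j. K i j + y) = setdet V K + y * c" for y
    unfolding c_def by (rule setdet_mat_add_const[OF V])
  have "setdet V (\<lambda>i j. K i j + x) = setdet V (\<lambda>i j. K j i + x)"
    using setdet_transpose[OF V, of "\<lambda>i j. K i j + x"] by simp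
  also have "\<dots> = setdet V (\<lambda>i j. (-1) * (K i j + - x))"
  proof (rule setdet_cong)
    fix i j show "K j i + x = - 1 * (K i j + - x)" using skew[of j i] by simp
  qed
  also have "\<dots> = setdet V (\<lambda>i j. K i j + - x)"
    unfolding setdet_scale[OF V] using ev by simp
  finally have "setdet V K + x * c = setdet V K + - x * c"
    unfolding lin .
  then have "x * c = - x * c" by (rule add_left_imp_eq)
  then have "x * c = 0" by auto
  then show ?thesis using lin[of x] by (simp only: add_0_right)
qed

text \<open>
  The bridge to matrices indexed by an initial segment of the natural numbers, which gives access
  to the theory of linear systems over a field.
\<close>

lemma setdet_eq_det:
  assumes e: "bij_betw e {0..<n} V"
  shows "setdet V M = det (mat n n (\<lambda>(i,j). M (e i) (e j)))"
proof -
  let ?U = "{0..<n}" and ?m = "map_permutation {0..<n} e"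
  let ?h = "map_permutation V (inv_into ?U e)"
  have inj: "inj_on e ?U" and img: "V = e ` ?U" using e by (auto simp: bij_betw_def)
  have e': "bij_betw (inv_into ?U e) V ?U" by (rule bij_betw_inv_into[OF e])
  have "det (mat n n (\<lambda>(i,j). M (e i) (e j)))
      = (\<Sum>p | p permutes ?U. of_int (sign p) * (\<Prod>i\<in>?U. M (e i) (e (p i))))"
    unfolding det_def'[OF mat_carrier]
  proof (rule sum.cong[OF refl])
    fix p assume "p \<in> {p. p permutes ?U}"
    then have "(\<Prod>i\<in>?U. mat n n (\<lambda>(i,j). M (e i) (e j)) $$ (i, p i)) = (\<Prod>i\<in>?U. M (e i) (e (p i)))"
      by (intro prod.cong) (auto dest: permutes_in_image)
    then show "of_int (sign p) * (\<Prod>i\<in>?U. mat n n (\<lambda>(i,j). M (e i) (e j)) $$ (i, p i))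
        = of_int (sign p) * (\<Prod>i\<in>?U. M (e i) (e (p i)))"
      by simp
  qed
  also have "\<dots> = (\<Sum>p | p permutes V. of_int (sign p) * (\<Prod>i\<in>V. M i (p i)))"
  proof (rule sum.reindex_bij_witness[where j = ?m and i = ?h])
    fix p assume p: "p \<in> {p. p permutes ?U}"
    then show "?m p \<in> {p. p permutes V}" using map_permutation_permutes[OF e] by auto
    show "?h (?m p) = p"
      using p inj e by (intro map_permutation_compose_inv[OF e]) auto
    have "(\<Prod>i\<in>V. M i (?m p i)) = (\<Prod>i\<in>?U. M (e i) (?m p (e i)))"
      unfolding img by (simp add: prod.reindex[OF inj])
    also have "\<dots> = (\<Prod>i\<in>?U. M (e i) (e (p i)))"
      by (rule prod.cong) (auto simp: map_permutation_apply[OF inj])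
    finally show "of_int (sign (?m p)) * (\<Prod>i\<in>V. M i (?m p i))
        = of_int (sign p) * (\<Prod>i\<in>?U. M (e i) (e (p i)))"
      using p by (simp add: sign_map_permutation[OF inj])
  next
    fix p assume p: "p \<in> {p. p permutes V}"
    then show "?h p \<in> {p. p permutes ?U}" using map_permutation_permutes[OF e'] by auto
    show "?m (?h p) = p"
      using p e by (intro map_permutation_compose_inv[OF e']) (auto simp: img f_inv_into_f)
  qed
  finally show ?thesis by (simp add: setdet_def)
qed

lemma kernel_if_setdet_zero:
  fixes M :: "'a \<Rightarrow> 'a \<Rightarrow> 'c::field"
  assumes V: "finite V" and det0: "setdet V M = 0"
  shows "\<exists>x. (\<exists>c\<in>V. x c \<noteq> 0) \<and> (\<forall>i\<in>V. (\<Sum>k\<in>V. M i k * x k) = 0)"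
proof -
  obtain e where e: "bij_betw e {0..<card V} V" using ex_bij_betw_nat_finite[OF V] by auto
  let ?n = "card V" and ?A = "mat (card V) (card V) (\<lambda>(i,j). M (e i) (e j))"
  define e' where "e' = inv_into {0..<?n} e"
  have e'e: "e' (e i) = i" if "i < ?n" for i
    unfolding e'_def using that e by (simp add: bij_betw_inv_into_left)
  have "det ?A = 0" using det0 setdet_eq_det[OF e] by metis
  then obtain v where v: "v \<in> carrier_vec ?n" "v \<noteq> 0\<^sub>v ?n" "?A *\<^sub>v v = 0\<^sub>v ?n"
    using det_0_iff_vec_prod_zero_field[of ?A ?n] by auto
  define x where "x = (\<lambda>k. v $ e' k)"
  obtain c where c: "c < ?n" "v $ c \<noteq> 0" using v(1,2) by (auto simp: vec_eq_iff)
  have "(\<Sum>k\<in>V. M i k * x k) = 0" if i: "i \<in> V" for i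
  proof -
    obtain i' where i': "i' < ?n" "i = e i'" using e i unfolding bij_betw_def by fastforce
    have "(\<Sum>k\<in>V. M i k * x k) = (\<Sum>k = 0..<?n. M (e i') (e k) * v $ k)"
      unfolding sum.reindex_bij_betw[OF e, symmetric] i' by (rule sum.cong) (auto simp: x_def e'e)
    also have "\<dots> = (?A *\<^sub>v v) $ i'"
      using i' v(1) by (simp add: scalar_prod_def)
    finally show ?thesis using v(3) i' by simp
  qed
  moreover have "e c \<in> V" "x (e c) \<noteq> 0" using c e by (auto simp: x_def e'e bij_betw_def)
  ultimately have "(\<exists>c\<in>V. x c \<noteq> 0) \<and> (\<forall>i\<in>V. (\<Sum>k\<in>V. M i k * x k) = 0)" by blast
  then show ?thesis by (rule exI[of _ x])
qed

lemma skew_quadratic_form_zero: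
  fixes K :: "'a \<Rightarrow> 'a \<Rightarrow> real"
  assumes skew: "\<And>i j. K j i = - K i j"
  shows "(\<Sum>i\<in>V. \<Sum>k\<in>V. x i * (K i k * x k)) = 0"
proof -
  have "(\<Sum>i\<in>V. \<Sum>k\<in>V. x i * (K i k * x k)) = (\<Sum>k\<in>V. \<Sum>i\<in>V. x i * (K i k * x k))"
    by (rule sum.swap)
  also have "\<dots> = (\<Sum>k\<in>V. \<Sum>i\<in>V. - (x k * (K k i * x i)))"
  proof (intro sum.cong refl)
    fix i k show "x i * (K i k * x k) = - (x k * (K k i * x i))" using skew[of k i] by simp
  qed
  also have "\<dots> = - (\<Sum>i\<in>V. \<Sum>k\<in>V. x i * (K i k * x k))"
    by (simp add: sum_negf)
  finally show ?thesis by simp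
qed

text \<open>
  On the segment from the identity matrix to \<open>K\<close> every point but the last is nonsingular, because the skew
  part contributes nothing to the quadratic form and the identity part is positive definite.  The
  determinant starts at \<open>1\<close> and so cannot become negative.
\<close>

lemma setdet_skew_nonneg:
  fixes K :: "'a \<Rightarrow> 'a \<Rightarrow> real"
  assumes V: "finite V" and skew: "\<And>i j. K j i = - K i j"
  shows "setdet V K \<ge> 0"
proof (rule ccontr)
  assume neg: "\<not> setdet V K \<ge> 0"
  define h where "h s = setdet V (\<lambda>i j. s * K i j + (if i = j then 1 - s else 0))" for s :: real
  have h0: "h 0 = 1"
    unfolding h_def by (rule setdet_unitriangular[OF V wf_on_bot]) auto
  have h1: "h 1 < 0" using neg by (simp add: h_def cong: if_cong)
  have "continuous_on {0..1} (\<lambda>s. if b then 1 - s else (0::real))" for b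
    by (cases b) (auto intro!: continuous_intros)
  then have "continuous_on {0..1} h"
    unfolding h_def setdet_def by (intro continuous_intros)
  then obtain s where s: "0 \<le> s" "s \<le> 1" "h s = 0"
    using IVT2'[of h 1 0 0] h0 h1 by auto
  have s1: "s < 1" using s h1 by (cases "s = 1") auto
  obtain x where c: "\<exists>c\<in>V. x c \<noteq> 0"
    and ker: "\<forall>i\<in>V. (\<Sum>k\<in>V. (s * K i k + (if i = k then 1 - s else 0)) * x k) = 0"
    using kernel_if_setdet_zero[OF V s(3)[unfolded h_def]] by (elim exE conjE)
  have "0 = (\<Sum>i\<in>V. x i * (\<Sum>k\<in>V. (s * K i k + (if i = k then 1 - s else 0)) * x k))"
    by (simp add: ker)
  also have "\<dots> = (\<Sum>i\<in>V. (\<Sum>k\<in>V. s * (x i * (K i k * x k))) + (1 - s) * (x i)\<^sup>2)"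
  proof (rule sum.cong[OF refl])
    fix i assume i: "i \<in> V"
    have "(\<Sum>k\<in>V. (s * K i k + (if i = k then 1 - s else 0)) * x k)
        = (\<Sum>k\<in>V. s * K i k * x k) + (1 - s) * x i"
      using V i by (simp add: distrib_right sum.distrib if_distrib[of "\<lambda>a. a * _"] cong: if_cong)
    then have "x i * (\<Sum>k\<in>V. (s * K i k + (if i = k then 1 - s else 0)) * x k)
        = x i * ((\<Sum>k\<in>V. s * K i k * x k) + (1 - s) * x i)"
      by (rule arg_cong)
    also have "\<dots> = (\<Sum>k\<in>V. s * (x i * (K i k * x k))) + (1 - s) * (x i)\<^sup>2"
      by (simp only: sum_distrib_left power2_eq_square distrib_left mult_ac)
    finally show "x i * (\<Sum>k\<in>V. (s * K i k + (if i = k then 1 - s else 0)) * x k)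
        = (\<Sum>k\<in>V. s * (x i * (K i k * x k))) + (1 - s) * (x i)\<^sup>2" .
  qed
  also have "\<dots> = (1 - s) * (\<Sum>i\<in>V. (x i)\<^sup>2)"
  proof -
    have "(\<Sum>i\<in>V. \<Sum>k\<in>V. s * (x i * (K i k * x k)))
        = s * (\<Sum>i\<in>V. \<Sum>k\<in>V. x i * (K i k * x k))"
      by (simp only: sum_distrib_left)
    also have "(\<Sum>i\<in>V. \<Sum>k\<in>V. x i * (K i k * x k)) = 0"
      by (rule skew_quadratic_form_zero) (rule skew)
    finally show ?thesis
      by (simp only: sum.distrib sum_distrib_left mult_zero_right add_0)
  qed
  finally have "(\<Sum>i\<in>V. (x i)\<^sup>2) = 0" using s1 by simp
  then show False using c V by (simp add: sum_nonneg_eq_0_iff)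
qed

section \<open>Principal minors of the skew adjacency matrix of a tournament\<close>

definition tournament_on :: "'a set \<Rightarrow> ('a \<Rightarrow> 'a \<Rightarrow> bool) \<Rightarrow> bool" where
  "tournament_on V E \<longleftrightarrow>
     (\<forall>u\<in>V. \<forall>v\<in>V. E u v \<longrightarrow> \<not> E v u) \<and> (\<forall>u\<in>V. \<forall>v\<in>V. u \<noteq> v \<longrightarrow> E u v \<or> E v u)"

lemma tournament_on_cases:
  assumes "tournament_on V E" "u \<in> V" "v \<in> V"
  obtains "u = v" "\<not> E u v" "\<not> E v u" | "u \<noteq> v" "E u v" "\<not> E v u" | "u \<noteq> v" "E v u" "\<not> E u v"
  using assms unfolding tournament_on_def by metis

text \<open>
  The matrix \<open>A\<^sup>T - A\<close> for the adjacency matrix \<open>A\<close> of the relation \<open>E\<close>.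
\<close>

definition skew_adj :: "('a \<Rightarrow> 'a \<Rightarrow> bool) \<Rightarrow> 'a \<Rightarrow> 'a \<Rightarrow> int" where
  "skew_adj E u v = of_bool (E v u) - of_bool (E u v)"

lemma skew_adj_antisym: "skew_adj E v u = - skew_adj E u v"
  by (simp add: skew_adj_def)

lemma tournament_on_subset: "tournament_on V E \<Longrightarrow> R \<subseteq> V \<Longrightarrow> tournament_on R E"
  unfolding tournament_on_def by blast

text \<open>
  Adding the all-ones matrix does not change the determinant and leads to \<open>I + 2 A\<^sup>T\<close>, which is the
  identity modulo 2.
\<close>

lemma odd_setdet_skew_adj:
  assumes R: "finite R" and T: "tournament_on R E" and ev: "even (card R)"
  shows "odd (setdet R (skew_adj E))"
proof -
  let ?B = "\<lambda>i j. of_bool (E j i) :: int"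
  have "setdet R (skew_adj E) = setdet R (\<lambda>i j. skew_adj E i j + 1)"
    by (rule setdet_skew_even_add_const[OF R _ ev, symmetric]) (rule skew_adj_antisym)
  also have "\<dots> = setdet R (\<lambda>i j. 2 * ?B i j + (if i = j then 1 else 0))"
  proof (rule setdet_cong)
    fix i j assume "i \<in> R" "j \<in> R"
    with T show "skew_adj E i j + 1 = 2 * ?B i j + (if i = j then 1 else 0)"
      by (cases rule: tournament_on_cases) (auto simp: skew_adj_def)
  qed
  also have "\<dots> = (\<Sum>S\<in>Pow R. setdet S (\<lambda>i j. 2 * ?B i j))"
    using setdet_add_diagonal[OF R, of _ "\<lambda>_. 1"] by simp
  also have "\<dots> = 1 + (\<Sum>S\<in>Pow R - {{}}. setdet S (\<lambda>i j. 2 * ?B i j))"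
    using R by (subst sum.remove[of _ "{}"]) auto
  also have "odd \<dots>"
  proof -
    have "even (\<Sum>S\<in>Pow R - {{}}. setdet S (\<lambda>i j. 2 * ?B i j))"
    proof (rule dvd_sum)
      fix S assume S: "S \<in> Pow R - {{}}"
      then have "finite S" using R by (auto intro: finite_subset)
      then show "even (setdet S (\<lambda>i j. 2 * ?B i j))"
        using S by (subst setdet_scale) (auto simp: card_gt_0_iff)
    qed
    then show ?thesis by simp
  qed
  finally show ?thesis .
qed

lemma setdet_skew_adj_ge_1:
  assumes R: "finite R" and T: "tournament_on R E" and ev: "even (card R)"
  shows "setdet R (skew_adj E) \<ge> 1"
proof -
  have "setdet R (\<lambda>i j. real_of_int (skew_adj E i j)) \<ge> 0"
    by (rule setdet_skew_nonneg[OF R]) (simp add: skew_adj_def)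
  then have "setdet R (skew_adj E) \<ge> 0" by (simp add: setdet_of_int)
  moreover have "setdet R (skew_adj E) \<noteq> 0" using odd_setdet_skew_adj[OF assms] by auto
  ultimately show ?thesis by simp
qed

text \<open>
  Local transitivity in terms of 3-cycles: a tournament has a directed cycle iff it has one
  of length 3.
\<close>

definition locally_transitive_on :: "'a set \<Rightarrow> ('a \<Rightarrow> 'a \<Rightarrow> bool) \<Rightarrow> bool" where
  "locally_transitive_on V E \<longleftrightarrow>
     (\<forall>v\<in>V. \<forall>a\<in>V. \<forall>b\<in>V. \<forall>c\<in>V. E a b \<longrightarrow> E b c \<longrightarrow> E c a \<longrightarrow>
        \<not> (E v a \<and> E v b \<and> E v c) \<and> \<not> (E a v \<and> E b v \<and> E c v))"

text \<open>
  Without 3-cycles the relation is transitive, hence acyclic by irreflexivity.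
\<close>

lemma wf_tournament_if_no_triangle:
  assumes R: "finite R" and T: "tournament_on R F"
    and tri: "\<And>a b c. a \<in> R \<Longrightarrow> b \<in> R \<Longrightarrow> c \<in> R \<Longrightarrow> F a b \<Longrightarrow> F b c \<Longrightarrow> F c a \<Longrightarrow> False"
  shows "wf {(u, v). u \<in> R \<and> v \<in> R \<and> F u v}" (is "wf ?r")
proof (rule finite_acyclic_wf)
  show "finite ?r" by (rule finite_subset[of _ "R \<times> R"]) (use R in auto)
  have "trans ?r"
  proof (rule transI)
    fix a b c assume "(a, b) \<in> ?r" "(b, c) \<in> ?r"
    then have abc: "a \<in> R" "b \<in> R" "c \<in> R" "F a b" "F b c" by auto
    have "\<not> F c a" using tri[OF abc] by blast
    with T abc show "(a, c) \<in> ?r"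
      using tournament_on_cases[OF T abc(1,3)] tournament_on_cases[OF T abc(1,2)] by blast
  qed
  then show "acyclic ?r"
    unfolding acyclic_def using T by (auto simp: tournament_on_def)
qed

text \<open>
  Fix a vertex \<open>v\<close> and reverse all arcs between the in-neighbours of \<open>v\<close> and the other vertices.
  On the matrix this is conjugation by a diagonal sign matrix.  In the new tournament \<open>v\<close> dominates every other
  vertex; a 3-cycle in it would come from a 3-cycle of the old tournament, possibly through \<open>v\<close>, whose
  vertices all dominate or are all dominated by a fourth vertex.  So the new tournament is transitive.
\<close>

lemma setdet_skew_adj_locally_transitive:
  assumes R: "finite R" and T: "tournament_on R E" and ev: "even (card R)"
    and lt: "locally_transitive_on R E"
  shows "setdet R (skew_adj E) = 1"
proof (cases "R = {}")
  case False
  then obtain v where v: "v \<in> R" by auto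
  \<comment> \<open>The sign \<open>s\<close> describes the cut across which arcs are reversed; \<open>F\<close> is the new tournament.\<close>
  define s :: "'a \<Rightarrow> int" where "s u = (if E u v then -1 else 1)" for u
  define F where "F u w = (if s u = s w then E u w else E w u)" for u w
  have F: "skew_adj F i j = s i * (s j * skew_adj E i j)" for i j
    by (auto simp: skew_adj_def F_def s_def)
  have s2: "prod s R * prod s R = 1"
    unfolding prod.distrib[symmetric] by (rule prod.neutral) (simp add: s_def)
  have TF: "tournament_on R F"
    using T unfolding tournament_on_def F_def by (auto split: if_splits)
  have vF: "\<not> F u v" if "u \<in> R" for u
    using that v T unfolding tournament_on_def F_def s_def by auto
  have tri: False if abc: "a \<in> R" "b \<in> R" "c \<in> R" "F a b" "F b c" "F c a" for a b c
  proof -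
    have ne: "a \<noteq> v" "b \<noteq> v" "c \<noteq> v" using vF abc by auto
    have nE: "E v a = (\<not> E a v)" "E v b = (\<not> E b v)" "E v c = (\<not> E c v)"
      using ne abc v T unfolding tournament_on_def by blast+
    have LT: "\<not> (E u x \<and> E u y \<and> E u z \<and> E x y \<and> E y z \<and> E z x)"
        "\<not> (E x u \<and> E y u \<and> E z u \<and> E x y \<and> E y z \<and> E z x)"
      if "u \<in> R" "x \<in> R" "y \<in> R" "z \<in> R" for u x y z
      using lt that unfolding locally_transitive_on_def by blast+
    \<comment> \<open>Each of the four candidate 3-cycles has the remaining vertex as apex; which of them is present in
      the old tournament depends on which of \<open>a\<close>, \<open>b\<close>, \<open>c\<close> are in-neighbours of \<open>v\<close>.\<close>
    note LTs = LT[OF v abc(1-3)] LT[OF abc(1) v abc(3,2)] LT[OF abc(2) v abc(1,3)] LT[OF abc(3) v abc(2,1)]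
    show False
      by (cases "E a v"; cases "E b v"; cases "E c v") (use abc(4-6) nE LTs in \<open>simp_all add: F_def s_def\<close>)
  qed
  have "setdet R (skew_adj E) = prod s R * (prod s R * setdet R (skew_adj E))"
    using s2 by (simp add: mult.assoc[symmetric])
  also have "\<dots> = setdet R (\<lambda>i j. s i * (s j * skew_adj E i j))"
    by (simp add: setdet_scale_rows[OF R] setdet_scale_columns[OF R])
  also have "\<dots> = setdet R (skew_adj F)"
    by (rule setdet_cong) (simp add: F)
  also have "\<dots> = setdet R (\<lambda>i j. skew_adj F i j + 1)"
    by (rule setdet_skew_even_add_const[OF R _ ev, symmetric]) (rule skew_adj_antisym)
  also have "\<dots> = 1"
  proof (rule setdet_unitriangular[OF R wf_tournament_if_no_triangle[OF R TF tri]])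
    fix i assume "i \<in> R"
    show "skew_adj F i i + 1 = 1" by (simp add: skew_adj_def)
  next
    fix i j assume ij: "i \<in> R" "j \<in> R" "i \<noteq> j" "(j, i) \<notin> {(u, v). u \<in> R \<and> v \<in> R \<and> F u v}"
    show "skew_adj F i j + 1 = 0"
      by (rule tournament_on_cases[OF TF ij(1,2)]) (use ij in \<open>auto simp: skew_adj_def\<close>)
  qed
  finally show ?thesis .
qed simp

text \<open>
  The columns of the three vertices of the cycle add up to \<open>\<plusminus>3\<close> times the unit vector at the apex \<open>v\<close>,
  because the entries of the cycle itself cancel in each row.  By Cramer's rule the determinant is a multiple of 3.
\<close>

lemma three_dvd_setdet_cone:
  assumes T: "tournament_on R E" and R: "R = {v, a, b, c}"
    and tri: "E a b" "E b c" "E c a"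
    and cone: "(E v a \<and> E v b \<and> E v c) \<or> (E a v \<and> E b v \<and> E c v)"
  shows "3 dvd setdet R (skew_adj E)" "card R = 4"
proof -
  have fin: "finite R" by (simp add: R)
  have asym: "\<not> E y x" if "x \<in> R" "y \<in> R" "E x y" for x y
    using T that by (auto simp: tournament_on_def)
  have reverse: "\<not> E b a" "\<not> E c b" "\<not> E a c"
    using asym[of a b] asym[of b c] asym[of c a] tri R by auto
  have spokes: "E v b = E v a" "E v c = E v a"
      "E a v = (\<not> E v a)" "E b v = (\<not> E v a)" "E c v = (\<not> E v a)"
    using cone asym[of v a] asym[of v b] asym[of v c] asym[of a v] asym[of b v] asym[of c v] R
    by auto
  have dist: "v \<noteq> a" "v \<noteq> b" "v \<noteq> c" "a \<noteq> b" "b \<noteq> c" "a \<noteq> c"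
    using reverse spokes tri by auto
  then show "card R = 4" by (simp add: R)
  define x :: "'a \<Rightarrow> int" where "x u = of_bool (u \<noteq> v)" for u
  define y :: "'a \<Rightarrow> int" where "y u = (if u = v then skew_adj E v a else 0)" for u
  have ker: "(\<Sum>k\<in>R. skew_adj E i k * x k) = 3 * y i" if "i \<in> R" for i
    using that dist unfolding R by (auto simp: x_def y_def skew_adj_def tri reverse spokes)
  have "setdet R (skew_adj E) = x a * setdet R (skew_adj E)" using dist by (simp add: x_def)
  also have "\<dots> = setdet R (\<lambda>i j. if j = a then \<Sum>k\<in>R. skew_adj E i k * x k else skew_adj E i j)"
    by (rule setdet_cramer[OF fin, symmetric]) (simp add: R)
  also have "\<dots> = setdet R (\<lambda>i j. (if j = a then 3 else 1) * (if j = a then y i else skew_adj E i j))"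
    by (rule setdet_cong) (auto simp: ker)
  also have "\<dots> = 3 * setdet R (\<lambda>i j. if j = a then y i else skew_adj E i j)"
    unfolding setdet_scale_columns[OF fin] using dist by (simp add: R)
  finally show "3 dvd setdet R (skew_adj E)" by simp
qed

lemma locally_transitive_if_setdet_skew_adj:
  assumes T: "tournament_on V E"
    and one: "\<And>R. R \<subseteq> V \<Longrightarrow> even (card R) \<Longrightarrow> setdet R (skew_adj E) = 1"
  shows "locally_transitive_on V E"
proof (rule ccontr)
  assume "\<not> locally_transitive_on V E"
  then obtain v a b c where "v \<in> V" "a \<in> V" "b \<in> V" "c \<in> V" and
    tri: "E a b" "E b c" "E c a" "(E v a \<and> E v b \<and> E v c) \<or> (E a v \<and> E b v \<and> E c v)"
    unfolding locally_transitive_on_def by blast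
  then have R: "{v, a, b, c} \<subseteq> V" by auto
  note cone = three_dvd_setdet_cone[OF tournament_on_subset[OF T R] refl tri]
  have "setdet {v, a, b, c} (skew_adj E) = 1" by (rule one[OF R]) (simp add: cone(2))
  then show False using cone(1) by simp
qed

text \<open>
  The right-hand side is twice the sum over the even \<open>R\<close>; this is where the two products of the
  main inequality come from.
\<close>

lemma prod_add_1_plus_prod_diff_1:
  fixes x :: "'a \<Rightarrow> 'c::comm_ring_1"
  assumes "finite V"
  shows "(\<Prod>v\<in>V. x v + 1) + (\<Prod>v\<in>V. x v - 1)
       = (\<Sum>R\<in>Pow V. prod x (V - R) * (1 + (-1) ^ card R))"
proof -
  have *: "(\<Prod>v\<in>V. x v + y) = (\<Sum>R\<in>Pow V. prod x (V - R) * y ^ card R)" for y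
    using prod_add[OF assms, of "\<lambda>_. y" x] by (simp add: add.commute mult.commute)
  show ?thesis
    using *[of 1] *[of "-1"] by (simp add: ring_distribs sum.distrib)
qed

text \<open>
  Both sides are sums over \<open>R \<subseteq> V\<close> with the positive weights \<open>\<Prod>v\<in>V - R. x v\<close>: on the left with
  coefficient \<open>2 det K\<^sub>R\<close>, on the right with coefficient \<open>2\<close> or \<open>0\<close> according to the parity
  of \<open>|R|\<close>.  The inequality and its equality case are read off term by term.
\<close>

lemma setdet_skew_adj_plus_diagonal:
  fixes x :: "'a \<Rightarrow> int"
  assumes V: "finite V" and T: "tournament_on V E" and pos: "\<And>v. v \<in> V \<Longrightarrow> x v > 0"
  defines "lhs \<equiv> 2 * setdet V (\<lambda>i j. skew_adj E i j + (if i = j then x i else 0))"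
    and "rhs \<equiv> (\<Prod>v\<in>V. x v + 1) + (\<Prod>v\<in>V. x v - 1)"
  shows "lhs \<ge> rhs" and "lhs = rhs \<longleftrightarrow> locally_transitive_on V E"
proof -
  \<comment> \<open>The contribution of \<open>R\<close> to the difference of the two sides.\<close>
  define t where "t R = prod x (V - R) * (2 * setdet R (skew_adj E) - (1 + (-1) ^ card R))" for R
  have diff: "lhs - rhs = (\<Sum>R\<in>Pow V. t R)"
    unfolding lhs_def rhs_def setdet_add_diagonal[OF V] prod_add_1_plus_prod_diff_1[OF V] t_def
    by (simp add: sum_distrib_left sum_subtractf[symmetric] right_diff_distrib mult_ac)
  have fin: "finite R" and TR: "tournament_on R E" and px: "prod x (V - R) > 0"
    if "R \<in> Pow V" for R
    using that V pos tournament_on_subset[OF T] by (auto intro: finite_subset prod_pos)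
  have odd: "t R = 0" if "R \<in> Pow V" "odd (card R)" for R
  proof -
    have "setdet R (skew_adj E) = 0"
      by (rule setdet_skew_odd[OF fin[OF that(1)] _ that(2)]) (rule skew_adj_antisym)
    then show ?thesis using that by (simp add: t_def)
  qed
  have even: "t R = prod x (V - R) * (2 * (setdet R (skew_adj E) - 1))" if "even (card R)" for R
    using that by (simp add: t_def)
  have nonneg: "t R \<ge> 0" if "R \<in> Pow V" for R
  proof (cases "even (card R)")
    case True
    then have "setdet R (skew_adj E) \<ge> 1" by (rule setdet_skew_adj_ge_1[OF fin TR, OF that that])
    then show ?thesis using even[OF True] px[OF that] by simp
  next
    case False
    then show ?thesis using odd[OF that] by simp
  qed
  then show "lhs \<ge> rhs" using diff sum_nonneg[of "Pow V" t] by simp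
  have "lhs = rhs \<longleftrightarrow> (\<Sum>R\<in>Pow V. t R) = 0" using diff by auto
  also have "\<dots> \<longleftrightarrow> (\<forall>R\<in>Pow V. t R = 0)"
    using V nonneg by (intro sum_nonneg_eq_0_iff) auto
  also have "\<dots> \<longleftrightarrow> (\<forall>R\<in>Pow V. even (card R) \<longrightarrow> setdet R (skew_adj E) = 1)"
  proof (rule ball_cong[OF refl])
    fix R assume R: "R \<in> Pow V"
    show "t R = 0 \<longleftrightarrow> (even (card R) \<longrightarrow> setdet R (skew_adj E) = 1)"
      using odd[OF R] even[of R] px[OF R] by (cases "even (card R)") auto
  qed
  also have "\<dots> \<longleftrightarrow> locally_transitive_on V E"
  proof
    assume "\<forall>R\<in>Pow V. even (card R) \<longrightarrow> setdet R (skew_adj E) = 1"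
    then show "locally_transitive_on V E" by (intro locally_transitive_if_setdet_skew_adj[OF T]) auto
  next
    assume lt: "locally_transitive_on V E"
    have "locally_transitive_on R E" if "R \<in> Pow V" for R
      using lt that unfolding locally_transitive_on_def by blast
    then show "\<forall>R\<in>Pow V. even (card R) \<longrightarrow> setdet R (skew_adj E) = 1"
      using setdet_skew_adj_locally_transitive[OF fin TR] by blast
  qed
  finally show "lhs = rhs \<longleftrightarrow> locally_transitive_on V E" .
qed

section \<open>The matrix-tree theorem\<close>

definition laplacian :: "'a set \<Rightarrow> ('a \<Rightarrow> 'a \<Rightarrow> bool) \<Rightarrow> 'a \<Rightarrow> 'a \<Rightarrow> int" where
  "laplacian V E i j = (if i = j then int (card {w\<in>V. E i w}) else 0) - of_bool (E i j)"

text \<open>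
  The arborescences rooted at \<open>r\<close>, given by the map that sends every other vertex to the head of its unique
  outgoing arc.  Letting \<open>f\<close> fix \<open>r\<close> and be undefined outside \<open>V\<close> makes \<open>f\<close> unique and allows iteration.
\<close>

definition parent_maps :: "'a set \<Rightarrow> ('a \<Rightarrow> 'a \<Rightarrow> bool) \<Rightarrow> 'a \<Rightarrow> ('a \<Rightarrow> 'a) set" where
  "parent_maps V E r =
     {f \<in> Pi\<^sub>E V (\<lambda>i. if i = r then {r} else {w\<in>V. E i w}). \<forall>v\<in>V. \<exists>k. (f ^^ k) v = r}"

lemma laplacian_rows_sum_zero:
  assumes "finite V" "i \<in> V"
  shows "(\<Sum>j\<in>V. laplacian V E i j) = 0"
  using assms by (simp add: laplacian_def sum_subtractf of_bool_def sum.If_cases Int_def)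

lemma laplacian_eq_sum:
  assumes "finite V" "j \<in> V"
  shows "laplacian V E i j = (\<Sum>w\<in>{w\<in>V. E i w}. of_bool (i = j) - of_bool (w = j))"
proof -
  have "(\<Sum>w\<in>{w\<in>V. E i w}. of_bool (w = j) :: int) = of_bool (E i j)"
    using assms by (simp add: of_bool_def sum.delta)
  then show ?thesis by (simp add: laplacian_def sum_subtractf)
qed

definition depth :: "('a \<Rightarrow> 'a) \<Rightarrow> 'a \<Rightarrow> 'a \<Rightarrow> nat" where
  "depth f r v = (LEAST k. (f ^^ k) v = r)"

lemma depth_step:
  assumes "(f ^^ k) v = r" "v \<noteq> r"
  shows "depth f r v = Suc (depth f r (f v))"
  unfolding depth_def using Least_Suc[of "\<lambda>k. (f ^^ k) v = r" k] assms
  by (simp add: funpow_Suc_right del: funpow.simps)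

lemma reaches_root_step:
  assumes "i \<noteq> r"
  shows "(\<exists>k. (f ^^ k) i = r) \<longleftrightarrow> (\<exists>k. (f ^^ k) (f i) = r)"
proof -
  have "\<exists>m. (f ^^ Suc m) i = r" if "(f ^^ k) i = r" for k
  proof (cases k)
    case 0
    with that \<open>i \<noteq> r\<close> show ?thesis by simp
  next
    case (Suc m)
    with that show ?thesis by (intro exI[of _ m]) (simp only:)
  qed
  then have "(\<exists>k. (f ^^ k) i = r) \<longleftrightarrow> (\<exists>k. (f ^^ Suc k) i = r)"
    by (intro iffI) (elim exE, assumption, elim exE, rule exI)
  also have "\<dots> \<longleftrightarrow> (\<exists>k. (f ^^ k) (f i) = r)"
    by (simp add: funpow_Suc_right del: funpow.simps)
  finally show ?thesis .
qed

text \<open>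
  If all vertices reach \<open>r\<close>, the matrix is unitriangular with respect to the distance to \<open>r\<close>.  Otherwise the
  indicator vector of the vertices that do not reach \<open>r\<close> lies in its kernel, since a vertex
  \<open>i \<noteq> r\<close> reaches \<open>r\<close> iff \<open>f i\<close> does.
\<close>

lemma setdet_map_rows:
  assumes V: "finite V" and r: "r \<in> V" and f: "f r = r" "\<And>i. i \<in> V \<Longrightarrow> f i \<in> V"
  shows "setdet V (\<lambda>i j. if i = r then of_bool (j = r) else of_bool (i = j) - of_bool (f i = j))
       = (of_bool (\<forall>v\<in>V. \<exists>k. (f ^^ k) v = r) :: int)" (is "setdet V ?M = _")
proof (cases "\<forall>v\<in>V. \<exists>k. (f ^^ k) v = r")
  case True
  have step: "depth f r (f v) < depth f r v" if "v \<in> V" "v \<noteq> r" for v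
  proof -
    from bspec[OF True that(1)] obtain k where "(f ^^ k) v = r" by (elim exE)
    then show ?thesis using depth_step[of k f v r] that by simp
  qed
  have "setdet V ?M = 1"
  proof (rule setdet_unitriangular[OF V wf_measure[of "depth f r"]])
    fix i assume i: "i \<in> V"
    have "f i \<noteq> i" if "i \<noteq> r" using step[OF i that] by auto
    then show "?M i i = 1" by auto
  next
    fix i j assume ij: "i \<in> V" "j \<in> V" "i \<noteq> j" "(j, i) \<notin> measure (depth f r)"
    have "f i \<noteq> j" if "i \<noteq> r" using step[OF ij(1) that] ij(4) by auto
    then show "?M i j = 0" using ij(3) by auto
  qed
  then show ?thesis by (rule trans) (rule of_bool_eq_1_iff[THEN iffD2, OF True, symmetric])
next
  case False
  define B where "B v \<longleftrightarrow> \<not> (\<exists>k. (f ^^ k) v = r)" for v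
  from False obtain b where b: "b \<in> V" "B b" by (auto simp: B_def)
  have B_step: "B (f i) \<longleftrightarrow> B i" if "i \<noteq> r" for i
    by (simp only: B_def reaches_root_step[OF that, of f])
  have Br: "\<not> B r" unfolding B_def by (auto intro!: exI[of _ "0::nat"])
  have "setdet V ?M = 0"
  proof (rule setdet_zero_if_kernel[OF V b(1), of "\<lambda>v. of_bool (B v)"])
    show "of_bool (B b) \<noteq> (0::int)" using b by simp
    fix i assume i: "i \<in> V"
    show "(\<Sum>k\<in>V. ?M i k * of_bool (B k)) = 0"
    proof (cases "i = r")
      case True
      then have "?M i k * of_bool (B k) = 0" for k using Br by (cases "k = r") auto
      then show ?thesis by (intro sum.neutral ballI)
    next
      case False
      have single: "(\<Sum>k\<in>V. of_bool (a = k) * of_bool (B k)) = (of_bool (B a) :: int)" if "a \<in> V" for a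
      proof -
        have "(\<Sum>k\<in>V. of_bool (a = k) * of_bool (B k)) = (\<Sum>k\<in>V. if a = k then of_bool (B a) else (0::int))"
          by (rule sum.cong) auto
        then show ?thesis using V that by (simp only: sum.delta' if_True)
      qed
      have "(\<Sum>k\<in>V. ?M i k * of_bool (B k))
          = (\<Sum>k\<in>V. of_bool (i = k) * of_bool (B k)) - (\<Sum>k\<in>V. of_bool (f i = k) * of_bool (B k))"
        using False by (simp only: if_False left_diff_distrib sum_subtractf)
      also have "\<dots> = 0" using single[OF i] single[OF f(2)[OF i]] B_step[OF False] by simp
      finally show ?thesis .
    qed
  qed
  then show ?thesis by (rule trans) (rule of_bool_eq_0_iff[THEN iffD2, OF False, symmetric])
qed

text \<open>
  Expanding all rows of the Laplacian into arcs leaves one determinant \<open>setdet_map_rows\<close> for each choice of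
  an outgoing arc at every vertex other than \<open>r\<close>.
\<close>

theorem matrix_tree:
  assumes V: "finite V" and r: "r \<in> V"
  shows "setdet V (\<lambda>i j. if i = r then of_bool (j = r) else laplacian V E i j)
       = int (card (parent_maps V E r))"
proof -
  let ?F = "\<lambda>i. if i = r then {r} else {w\<in>V. E i w}"
  let ?g = "\<lambda>i w j. if i = r then of_bool (j = r) else of_bool (i = j) - of_bool (w = j) :: int"
  have fin: "finite (?F i)" for i using V by auto
  have "setdet V (\<lambda>i j. if i = r then of_bool (j = r) else laplacian V E i j)
      = setdet V (\<lambda>i j. \<Sum>w\<in>?F i. ?g i w j)"
    by (rule setdet_cong) (simp add: laplacian_eq_sum[OF V])
  also have "\<dots> = (\<Sum>f\<in>Pi\<^sub>E V ?F. setdet V (\<lambda>i j. ?g i (f i) j))"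
    by (rule setdet_sum_rows[OF V fin])
  also have "\<dots> = (\<Sum>f\<in>Pi\<^sub>E V ?F. of_bool (\<forall>v\<in>V. \<exists>k. (f ^^ k) v = r))"
  proof (rule sum.cong[OF refl])
    fix f assume f: "f \<in> Pi\<^sub>E V ?F"
    have "f r = r" using PiE_mem[OF f r] by simp
    moreover have "f i \<in> V" if "i \<in> V" for i
      using PiE_mem[OF f that] r by (cases "i = r") simp_all
    ultimately show "setdet V (\<lambda>i j. ?g i (f i) j) = of_bool (\<forall>v\<in>V. \<exists>k. (f ^^ k) v = r)"
      by (rule setdet_map_rows[OF V r])
  qed
  also have "\<dots> = int (card (parent_maps V E r))"
    unfolding parent_maps_def using finite_PiE[OF V fin]
    by (simp add: of_bool_def sum.If_cases Int_def)
  finally show ?thesis .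
qed

text \<open>
  The row \<open>1 - n e\<^sub>r\<close> sums to zero, as the other rows do.  Hence the matrix with this row in place of row \<open>r\<close>
  kills the constant vector.
\<close>

lemma setdet_ones_row:
  fixes M :: "'a \<Rightarrow> 'a \<Rightarrow> int"
  assumes V: "finite V" and r: "r \<in> V" and rows: "\<And>i. i \<in> V \<Longrightarrow> (\<Sum>j\<in>V. M i j) = 0"
  shows "setdet V (\<lambda>i j. if i = r then 1 else M i j)
       = int (card V) * setdet V (\<lambda>i j. if i = r then of_bool (j = r) else M i j)"
proof -
  let ?n = "int (card V)"
  have "setdet V (\<lambda>i j. if i = r then 1 + (- ?n) * of_bool (j = r) else M i j) = 0"
  proof (rule setdet_zero_if_kernel[OF V r, of "\<lambda>_. 1"])
    fix i assume i: "i \<in> V"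
    have "(\<Sum>k\<in>V. of_bool (k = r) :: int) = 1" using V r by (simp add: of_bool_def)
    then have "(\<Sum>k\<in>V. 1 + (- ?n) * of_bool (k = r)) = 0"
      by (simp only: sum.distrib sum_distrib_left[symmetric] sum_constant)
    then show "(\<Sum>k\<in>V. (if i = r then 1 + (- ?n) * of_bool (k = r) else M i k) * 1) = 0"
      using rows[OF i] by (cases "i = r") simp_all
  qed simp
  then have "setdet V (\<lambda>i j. if i = r then 1 else M i j)
      + (- ?n) * setdet V (\<lambda>i j. if i = r then of_bool (j = r) else M i j) = 0"
    by (simp only: setdet_row_add[OF V r] setdet_scale_row[OF V r])
  then show ?thesis by simp
qed

text \<open>
  The Laplacian is singular, so only the linear term of \<open>setdet_mat_add_const\<close> remains.  The factor 2 on
  the left avoids the exponent \<open>card V - 1\<close> on the right.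
\<close>

lemma setdet_laplacian_plus_ones:
  assumes V: "finite V" "V \<noteq> {}"
  shows "2 * setdet V (\<lambda>i j. 2 * laplacian V E i j + 1)
       = 2 ^ card V * int (card V) * (\<Sum>r\<in>V. int (card (parent_maps V E r)))"
proof -
  let ?L = "laplacian V E"
  have "setdet V (\<lambda>i j. 2 * ?L i j) = 0"
  proof -
    obtain c where "c \<in> V" using V by auto
    moreover have "(\<Sum>k\<in>V. 2 * ?L i k * 1) = 0" if "i \<in> V" for i
      using laplacian_rows_sum_zero[OF V(1) that] by (simp only: mult_1_right sum_distrib_left[symmetric] mult_zero_right)
    ultimately show ?thesis
      by (intro setdet_zero_if_kernel[OF V(1), of c "\<lambda>_. 1"]) auto
  qed
  then have "2 * setdet V (\<lambda>i j. 2 * ?L i j + 1)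
      = (\<Sum>r\<in>V. 2 * setdet V (\<lambda>i j. if i = r then 1 else 2 * ?L i j))"
    by (simp add: setdet_mat_add_const[OF V(1)] sum_distrib_left)
  also have "\<dots> = (\<Sum>r\<in>V. 2 ^ card V * (int (card V) * int (card (parent_maps V E r))))"
  proof (rule sum.cong[OF refl])
    fix r assume r: "r \<in> V"
    have "setdet V (\<lambda>i j. if i = r then 1 else 2 * ?L i j)
        = setdet V (\<lambda>i j. (if i = r then 1 else 2) * (if i = r then 1 else ?L i j))"
      by (rule setdet_cong) simp
    also have "\<dots> = 2 ^ (card V - 1) * setdet V (\<lambda>i j. if i = r then 1 else ?L i j)"
      unfolding setdet_scale_rows[OF V(1)] using V r by (simp add: prod.remove[of V r])
    also have "\<dots> = 2 ^ (card V - 1) * (int (card V) * int (card (parent_maps V E r)))"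
      using setdet_ones_row[OF V(1) r laplacian_rows_sum_zero[OF V(1)]] matrix_tree[OF V(1) r] by simp
    finally have "2 * setdet V (\<lambda>i j. if i = r then 1 else 2 * ?L i j)
        = 2 ^ (card V - 1) * 2 * (int (card V) * int (card (parent_maps V E r)))"
      by (simp only: mult_ac)
    also have "(2::int) ^ (card V - 1) * 2 = 2 ^ card V"
      by (rule power_minus_mult) (use V in \<open>simp add: card_gt_0_iff\<close>)
    finally show "2 * setdet V (\<lambda>i j. if i = r then 1 else 2 * ?L i j)
        = 2 ^ card V * (int (card V) * int (card (parent_maps V E r)))" .
  qed
  finally show ?thesis by (simp only: sum_distrib_left mult.assoc)
qed

text \<open>
  The purely combinatorial form of the theorem: \<open>2 L + J\<close> is the matrix \<open>K\<close> plus the diagonal matrix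
  of the numbers \<open>2 d v + 1\<close>, so that \<open>setdet_laplacian_plus_ones\<close> and
  \<open>setdet_skew_adj_plus_diagonal\<close> speak about the same determinant.
\<close>

theorem parent_maps_tournament:
  assumes V: "finite V" "V \<noteq> {}" and T: "tournament_on V E"
  defines "d \<equiv> \<lambda>v. card {w\<in>V. E v w}"
  defines "lhs \<equiv> card V * (\<Sum>r\<in>V. card (parent_maps V E r))"
    and "rhs \<equiv> (\<Prod>v\<in>V. d v + 1) + (\<Prod>v\<in>V. d v)"
  shows "lhs \<ge> rhs" and "lhs = rhs \<longleftrightarrow> locally_transitive_on V E"
proof -
  let ?x = "\<lambda>v. 2 * int (d v) + 1"
  have "2 * setdet V (\<lambda>i j. skew_adj E i j + (if i = j then ?x i else 0))
      = 2 * setdet V (\<lambda>i j. 2 * laplacian V E i j + 1)"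
  proof (intro arg_cong[where f = "(*) 2"] setdet_cong)
    fix i j assume ij: "i \<in> V" "j \<in> V"
    show "skew_adj E i j + (if i = j then ?x i else 0) = 2 * laplacian V E i j + 1"
      by (rule tournament_on_cases[OF T ij]) (auto simp: skew_adj_def laplacian_def d_def)
  qed
  also have "\<dots> = 2 ^ card V * int lhs"
    unfolding setdet_laplacian_plus_ones[OF V] lhs_def by simp
  finally have l: "2 * setdet V (\<lambda>i j. skew_adj E i j + (if i = j then ?x i else 0)) = 2 ^ card V * int lhs" .
  have "(\<Prod>v\<in>V. ?x v + 1) = (\<Prod>v\<in>V. 2 * int (d v + 1))"
    by (rule prod.cong) auto
  moreover have "(\<Prod>v\<in>V. ?x v - 1) = (\<Prod>v\<in>V. 2 * int (d v))"
    by (rule prod.cong) auto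
  ultimately have r: "(\<Prod>v\<in>V. ?x v + 1) + (\<Prod>v\<in>V. ?x v - 1) = 2 ^ card V * int rhs"
    unfolding prod.distrib rhs_def by (simp add: distrib_left)
  have pos: "?x v > 0" for v by simp
  note main = setdet_skew_adj_plus_diagonal[where x = ?x, OF V(1) T pos, unfolded l r]
  show "lhs \<ge> rhs" using main(1) by simp
  show "lhs = rhs \<longleftrightarrow> locally_transitive_on V E" using main(2) by simp
qed

section \<open>Arborescences as parent maps\<close>

lemma pcas_nth:
  assumes "pcas u p v"
  shows "i < length p \<Longrightarrow> fst (p ! i) = (if i = 0 then u else snd (p ! (i - 1)))"
    and "p \<noteq> [] \<Longrightarrow> snd (last p) = v"
proof -
  have "(\<forall>i<length p. fst (p ! i) = (if i = 0 then u else snd (p ! (i - 1)))) \<and>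
        (p \<noteq> [] \<longrightarrow> snd (last p) = v)"
    using assms
  proof (induction p arbitrary: u)
    case (Cons e p)
    have IH: "\<forall>i<length p. fst (p ! i) = (if i = 0 then snd e else snd (p ! (i - 1)))"
      "p \<noteq> [] \<longrightarrow> snd (last p) = v"
      using Cons.IH[of "snd e"] Cons.prems by auto
    have "fst ((e # p) ! i) = (if i = 0 then u else snd ((e # p) ! (i - 1)))"
      if "i < length (e # p)" for i
    proof (cases i)
      case 0
      then show ?thesis using Cons.prems by simp
    next
      case (Suc k)
      then have "fst (p ! k) = (if k = 0 then snd e else snd (p ! (k - 1)))"
        using IH(1) that by simp
      then show ?thesis using Suc by (cases k) simp_all
    qed
    moreover have "snd (last (e # p)) = v"
      using IH(2) Cons.prems by (cases p) simp_all
    ultimately show ?case by blast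
  qed simp
  then show "i < length p \<Longrightarrow> fst (p ! i) = (if i = 0 then u else snd (p ! (i - 1)))"
    and "p \<noteq> [] \<Longrightarrow> snd (last p) = v" by blast+
qed

text \<open>
  Meant for the symmetric graph of a tree with parent map \<open>f\<close> and depth \<open>h\<close>.  At a vertex of maximal
  height on a cycle, the predecessor and the successor can only be its parent, so they are equal and the cycle
  has length at most 2.
\<close>

lemma no_long_cycle_if_height:
  fixes h :: "'a \<Rightarrow> nat"
  assumes arc: "\<And>x y. (x, y) \<in> parcs G \<Longrightarrow> (y = f x \<and> h y < h x) \<or> (x = f y \<and> h x < h y)"
    and cyc: "pre_digraph.cycle (with_proj G) p" and len: "length p \<ge> 3"
  shows False
proof -
  \<comment> \<open>\<open>?n\<close> is the cyclic predecessor of an index, and \<open>k\<close> below the cyclic successor of \<open>i\<close>.\<close>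
  let ?m = "length p" and ?n = "\<lambda>i. if i = 0 then length p - 1 else i - 1"
  from cyc obtain u where walk: "set p \<subseteq> parcs G" "pcas u p u"
    and dist: "distinct (tl (pre_digraph.awalk_verts (with_proj G) u p))"
    unfolding pre_digraph.cycle_def pre_digraph.awalk_def cas_with_proj_eq by auto
  have ne: "p \<noteq> []" using len by auto
  have "distinct (map snd p)"
    using dist walk(2) ne pre_digraph.awalk_verts_conv'[of "with_proj G" u p u]
    by (simp add: cas_with_proj_eq)
  then have inj: "i = j" if "snd (p ! i) = snd (p ! j)" "i < ?m" "j < ?m" for i j
    using that by (simp add: distinct_conv_nth) metis
  have arcs: "(snd (p ! ?n i), snd (p ! i)) \<in> parcs G" if "i < ?m" for i
  proof -
    have "fst (p ! i) = snd (p ! ?n i)"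
      using pcas_nth[OF walk(2)] that ne by (simp add: last_conv_nth)
    moreover have "p ! i \<in> parcs G" using walk(1) that by auto
    ultimately show ?thesis by (metis prod.collapse)
  qed
  obtain i where i: "i < ?m" and max: "\<And>j. j < ?m \<Longrightarrow> h (snd (p ! j)) \<le> h (snd (p ! i))"
  proof -
    let ?S = "(\<lambda>j. h (snd (p ! j))) ` {..<?m}"
    have "Max ?S \<in> ?S" using ne by (intro Max_in) auto
    then obtain i where "i < ?m" "h (snd (p ! i)) = Max ?S" by auto
    then show ?thesis using that[of i] by simp
  qed
  define k where "k = (if Suc i = ?m then 0 else Suc i)"
  have k: "k < ?m" "?n k = i" using i len by (auto simp: k_def)
  have n: "?n i < ?m" using i by auto
  have "snd (p ! ?n i) = f (snd (p ! i))"
    using arc[OF arcs[OF i]] max[OF n] by auto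
  moreover have "snd (p ! k) = f (snd (p ! i))"
    using arc[OF arcs[OF k(1), unfolded k(2)]] max[OF k(1)] by auto
  ultimately have "?n i = k" using inj[OF _ n k(1)] by simp
  then show False using i len by (auto simp: k_def split: if_splits)
qed

lemma (in digraph) ex1_arc:
  assumes "u \<rightarrow> v"
  shows "\<exists>!e. e \<in> arcs G \<and> tail G e = u \<and> head G e = v"
proof -
  obtain e where "e \<in> arcs G" "tail G e = u" "head G e = v" using assms by auto
  then show ?thesis using no_multi_arcs by (auto simp: arc_to_ends_def)
qed

lemma (in digraph) out_degree_eq_card_out_neighbors:
  "out_degree G v = card {w \<in> verts G. v \<rightarrow> w}"
proof -
  have "bij_betw (head G) (out_arcs G v) {w \<in> verts G. v \<rightarrow> w}"
  proof (rule bij_betw_imageI)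
    show "inj_on (head G) (out_arcs G v)"
      by (rule inj_onI) (auto intro!: no_multi_arcs simp: arc_to_ends_def)
    show "head G ` out_arcs G v = {w \<in> verts G. v \<rightarrow> w}"
      by (force simp: arcs_ends_conv)
  qed
  then show ?thesis unfolding out_degree_def by (rule bij_betw_same_card)
qed

text \<open>
  The arc set of the arborescence with parent map \<open>f\<close>.
\<close>

definition parent_arcs :: "('a, 'b) pre_digraph \<Rightarrow> 'a \<Rightarrow> ('a \<Rightarrow> 'a) \<Rightarrow> 'b set" where
  "parent_arcs G r f = {e \<in> arcs G. tail G e \<noteq> r \<and> head G e = f (tail G e)}"

lemma parcs_mk_symmetric_arcs: "parcs (mk_symmetric (G\<lparr>arcs := A\<rparr>)) =
    {(x, y). \<exists>e\<in>A. (tail G e = x \<and> head G e = y) \<or> (tail G e = y \<and> head G e = x)}"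
  by (auto simp: mk_symmetric_def)

lemma pverts_mk_symmetric_arcs: "pverts (mk_symmetric (G\<lparr>arcs := A\<rparr>)) = verts G"
  by (simp add: mk_symmetric_def)

context digraph
begin

abbreviation "parents \<equiv> parent_maps (verts G) (\<lambda>u v. u \<rightarrow> v)"

lemma parents_root: "f \<in> parents r \<Longrightarrow> r \<in> verts G \<Longrightarrow> f r = r"
  unfolding parent_maps_def by (auto dest: PiE_mem)

lemma parents_step:
  assumes "f \<in> parents r" "v \<in> verts G" "v \<noteq> r"
  shows "f v \<in> verts G" "v \<rightarrow> f v" "depth f r (f v) < depth f r v"
proof -
  have "f v \<in> (if v = r then {r} else {w \<in> verts G. v \<rightarrow> w})"
    using assms(1,2) unfolding parent_maps_def by (auto dest: PiE_mem)
  then show "f v \<in> verts G" "v \<rightarrow> f v" using assms(3) by auto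
  obtain k where "(f ^^ k) v = r" using assms(1,2) unfolding parent_maps_def by auto
  then show "depth f r (f v) < depth f r v" using depth_step[of k f v r] assms(3) by simp
qed

lemma parent_arc:
  assumes "f \<in> parents r" "v \<in> verts G" "v \<noteq> r"
  obtains e where "{e \<in> parent_arcs G r f. tail G e = v} = {e}" "head G e = f v"
proof -
  from ex1_arc[OF parents_step(2)[OF assms]] obtain e where
    e: "e \<in> arcs G" "tail G e = v" "head G e = f v" and
    uniq: "\<And>e'. e' \<in> arcs G \<Longrightarrow> tail G e' = v \<Longrightarrow> head G e' = f v \<Longrightarrow> e' = e" by (elim ex1E) blast
  have "{e \<in> parent_arcs G r f. tail G e = v} = {e}"
  proof (intro equalityI subsetI)
    fix x assume "x \<in> {e \<in> parent_arcs G r f. tail G e = v}"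
    then have "x \<in> arcs G" "tail G x = v" "head G x = f v" by (auto simp: parent_arcs_def)
    then have "x = e" by (rule uniq)
    then show "x \<in> {e}" by simp
  next
    fix x assume "x \<in> {e}"
    then show "x \<in> {e \<in> parent_arcs G r f. tail G e = v}" using e assms(3) by (simp add: parent_arcs_def)
  qed
  then show ?thesis using e(3) that by blast
qed

text \<open>
  Every vertex is joined to \<open>r\<close> by following \<open>f\<close>, and \<open>no_long_cycle_if_height\<close> with the depth as
  height excludes cycles.
\<close>

lemma arborescence_parent_arcs:
  assumes f: "f \<in> parents r" and r: "r \<in> verts G"
  shows "arborescence G r (parent_arcs G r f)"
proof -
  let ?A = "parent_arcs G r f"
  let ?S = "with_proj (mk_symmetric (G\<lparr>arcs := ?A\<rparr>))"
  have edge: "(v, f v) \<in> arcs_ends ?S" "(f v, v) \<in> arcs_ends ?S" if "v \<in> verts G" "v \<noteq> r" for v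
    using parent_arc[OF f that] by (auto simp: parcs_mk_symmetric_arcs)
  have reach: "(v, r) \<in> rtrancl_on (verts G) (arcs_ends ?S) \<and> (r, v) \<in> rtrancl_on (verts G) (arcs_ends ?S)"
    if "v \<in> verts G" for v
    using that
  proof (induction "depth f r v" arbitrary: v rule: less_induct)
    case less
    show ?case
    proof (cases "v = r")
      case True
      then show ?thesis using r by simp
    next
      case False
      note step = parents_step[OF f less.prems False] and e = edge[OF less.prems False]
      have IH: "(f v, r) \<in> rtrancl_on (verts G) (arcs_ends ?S)" "(r, f v) \<in> rtrancl_on (verts G) (arcs_ends ?S)"
        using less.hyps[OF step(3) step(1)] by (rule conjunct1, rule conjunct2)
      show ?thesis
        using converse_rtrancl_on_into_rtrancl_on[OF e(1) IH(1) less.prems]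
          rtrancl_on_into_rtrancl_on[OF IH(2) e(2) less.prems] by (rule conjI)
    qed
  qed
  have "connected (G\<lparr>arcs := ?A\<rparr>)"
    unfolding connected_def strongly_connected_def reachable_def
    using r reach by (auto simp: pverts_mk_symmetric_arcs simp del: with_proj_simps(3) intro: rtrancl_on_trans)
  moreover have "False" if "pre_digraph.cycle ?S p" "length p \<ge> 3" for p
  proof (rule no_long_cycle_if_height[OF _ that])
    fix x y assume "(x, y) \<in> parcs (mk_symmetric (G\<lparr>arcs := ?A\<rparr>))"
    then obtain e where e: "e \<in> ?A" "(tail G e = x \<and> head G e = y) \<or> (tail G e = y \<and> head G e = x)"
      unfolding parcs_mk_symmetric_arcs by auto
    have "depth f r (f (tail G e)) < depth f r (tail G e)" "head G e = f (tail G e)"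
      using e(1) parents_step(3)[OF f] unfolding parent_arcs_def by auto
    then show "(y = f x \<and> depth f r y < depth f r x) \<or> (x = f y \<and> depth f r x < depth f r y)"
      using e(2) by auto
  qed
  moreover have "out_degree (G\<lparr>arcs := ?A\<rparr>) r = 0"
  proof -
    have "out_arcs (G\<lparr>arcs := ?A\<rparr>) r = {}" by (auto simp: out_arcs_def parent_arcs_def)
    then show ?thesis by (simp add: out_degree_def)
  qed
  moreover have "out_degree (G\<lparr>arcs := ?A\<rparr>) v = 1" if v: "v \<in> verts G - {r}" for v
  proof -
    obtain e where "{e \<in> ?A. tail G e = v} = {e}" by (rule parent_arc[OF f, of v]) (use v in auto)
    then show ?thesis by (simp add: out_degree_def out_arcs_def)
  qed
  moreover have "?A \<subseteq> arcs G" by (auto simp: parent_arcs_def)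
  ultimately show ?thesis
    unfolding arborescence_def underlying_tree_def using r by blast
qed

lemma inj_on_parent_arcs:
  assumes r: "r \<in> verts G"
  shows "inj_on (parent_arcs G r) (parents r)"
proof (rule inj_onI, rule ext)
  fix f g v
  assume f: "f \<in> parents r" and g: "g \<in> parents r" and eq: "parent_arcs G r f = parent_arcs G r g"
  consider "v \<notin> verts G" | "v = r" | "v \<in> verts G" "v \<noteq> r" by auto
  then show "f v = g v"
  proof cases
    case 1
    have undef: "h v = undefined" if "h \<in> parents r" for h
      using that PiE_arb[OF _ 1] unfolding parent_maps_def by blast
    show ?thesis using undef[OF f] undef[OF g] by (rule trans[OF _ sym])
  next
    case 2
    then show ?thesis using parents_root[OF f r] parents_root[OF g r] by simp
  next
    case 3
    obtain e where "{e \<in> parent_arcs G r f. tail G e = v} = {e}" "head G e = f v"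
      by (rule parent_arc[OF f 3])
    moreover obtain e' where "{e \<in> parent_arcs G r g. tail G e = v} = {e'}" "head G e' = g v"
      by (rule parent_arc[OF g 3])
    ultimately show ?thesis using eq by simp
  qed
qed

text \<open>
  The out-degree conditions determine the parent map.  The set of vertices whose \<open>f\<close>-orbit reaches \<open>r\<close> is
  closed under adjacency in the underlying graph, so by connectedness it contains every vertex.
\<close>

lemma arborescence_ex_parents:
  assumes A: "arborescence G r A"
  obtains f where "f \<in> parents r" "A = parent_arcs G r f"
proof -
  have r: "r \<in> verts G" and sub: "A \<subseteq> arcs G"
    and conn: "connected (G\<lparr>arcs := A\<rparr>)"
    and d0: "out_degree (G\<lparr>arcs := A\<rparr>) r = 0"
    and d1: "\<And>v. v \<in> verts G \<Longrightarrow> v \<noteq> r \<Longrightarrow> out_degree (G\<lparr>arcs := A\<rparr>) v = 1"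
    using A unfolding arborescence_def underlying_tree_def by auto
  have out: "out_degree (G\<lparr>arcs := A\<rparr>) v = card {e \<in> A. tail G e = v}" for v
    by (simp add: out_degree_def out_arcs_def)
  have fin: "finite {e \<in> A. tail G e = v}" for v using sub finite_subset by fastforce
  have root: "tail G e \<noteq> r" if "e \<in> A" for e
    using d0 fin[of r] that unfolding out by auto
  have "\<exists>e. {e \<in> A. tail G e = v} = {e}" if "v \<in> verts G" "v \<noteq> r" for v
    using d1[OF that] unfolding out by (rule card_1_singletonE) blast
  then obtain a where a: "\<And>v. v \<in> verts G \<Longrightarrow> v \<noteq> r \<Longrightarrow> {e \<in> A. tail G e = v} = {a v}" by metis
  have aA: "a v \<in> A" "tail G (a v) = v" if "v \<in> verts G" "v \<noteq> r" for v
    using a[OF that] by auto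
  have a_uniq: "e = a (tail G e)" if "e \<in> A" for e
  proof -
    have "tail G e \<in> verts G" using that sub by auto
    then show ?thesis using a[OF _ root[OF that]] that by blast
  qed
  define f where "f v = (if v = r then r else if v \<in> verts G then head G (a v) else undefined)" for v
  have head: "head G e = f (tail G e)" if "e \<in> A" for e
    using a_uniq[OF that] that sub root[OF that] by (auto simp: f_def)
  have step: "f v \<in> verts G" "v \<rightarrow> f v" if "v \<in> verts G" "v \<noteq> r" for v
  proof -
    have "a v \<in> arcs G" using aA[OF that] sub by auto
    then show "f v \<in> verts G" "v \<rightarrow> f v"
      using aA[OF that] that in_arcs_imp_in_arcs_ends[of "a v"] by (auto simp: f_def)
  qed
  have "A = parent_arcs G r f"
  proof (intro equalityI subsetI)
    fix e assume "e \<in> A"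
    then show "e \<in> parent_arcs G r f" using sub root head by (auto simp: parent_arcs_def)
  next
    fix e assume "e \<in> parent_arcs G r f"
    then have e: "e \<in> arcs G" "tail G e \<noteq> r" "head G e = f (tail G e)" by (auto simp: parent_arcs_def)
    let ?e = "a (tail G e)"
    have e': "?e \<in> A" "tail G ?e = tail G e" using aA[of "tail G e"] e by auto
    have "e = ?e"
      using e e' sub head[OF e'(1)] by (intro no_multi_arcs) (auto simp: arc_to_ends_def)
    then show "e \<in> A" using e'(1) by simp
  qed
  moreover have "f \<in> parents r"
  proof -
    have "f \<in> Pi\<^sub>E (verts G) (\<lambda>i. if i = r then {r} else {w \<in> verts G. i \<rightarrow> w})"
      using step r by (auto simp: PiE_iff f_def extensional_def)
    moreover have "\<exists>k. (f ^^ k) v = r" if v: "v \<in> verts G" for v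
    proof -
      define B where "B x \<longleftrightarrow> (\<exists>k. (f ^^ k) x = r)" for x
      have B_step: "B x \<longleftrightarrow> B (f x)" if "x \<noteq> r" for x
        using reaches_root_step[OF that, of f] by (simp add: B_def)
      have "(r, v) \<in> rtrancl_on (verts G) (parcs (mk_symmetric (G\<lparr>arcs := A\<rparr>)))"
        using conn r v unfolding connected_def strongly_connected_def reachable_def
        by (simp add: pverts_mk_symmetric_arcs)
      then have "B v"
      proof (induction rule: rtrancl_on_induct)
        case base
        show ?case unfolding B_def by (rule exI[of _ 0]) simp
      next
        case (step x y)
        from step.hyps(2) obtain e where e: "e \<in> A"
          "(tail G e = x \<and> head G e = y) \<or> (tail G e = y \<and> head G e = x)"
          unfolding parcs_mk_symmetric_arcs by auto
        then show ?case using B_step[OF root[OF e(1)]] head[OF e(1)] step.IH by auto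
      qed
      then show ?thesis by (simp add: B_def)
    qed
    ultimately show ?thesis unfolding parent_maps_def by blast
  qed
  ultimately show ?thesis using that by blast
qed

theorem arb_eq_card_parents:
  assumes r: "r \<in> verts G"
  shows "arb G r = card (parents r)"
proof -
  have "{A. arborescence G r A} = parent_arcs G r ` parents r"
    using arborescence_parent_arcs[OF _ r] arborescence_ex_parents by blast
  then show ?thesis
    unfolding arb_def using card_image[OF inj_on_parent_arcs[OF r]] by simp
qed

end

section \<open>Local transitivity and the inequality\<close>

lemma tournament_on_dominates:
  assumes "tournament T"
  shows "tournament_on (verts T) (\<lambda>u v. u \<rightarrow>\<^bsub>T\<^esub> v)"
proof -
  interpret digraph T using assms by (simp add: tournament_def)
  have "u \<noteq> v" if "u \<rightarrow>\<^bsub>T\<^esub> v" for u v using that adj_not_same by auto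
  then show ?thesis using assms unfolding tournament_def tournament_on_def by blast
qed

text \<open>
  A shortest directed cycle in a tournament has length 3; formally, \<open>wf_tournament_if_no_triangle\<close> excludes
  all closed walks once the 3-cycles are excluded.
\<close>

lemma transitive_tournament_induced_iff:
  assumes T: "tournament T" and S: "S \<subseteq> verts T"
  shows "transitive_tournament (T \<restriction> S) \<longleftrightarrow>
    (\<forall>a\<in>S. \<forall>b\<in>S. \<forall>c\<in>S. \<not> (a \<rightarrow>\<^bsub>T\<^esub> b \<and> b \<rightarrow>\<^bsub>T\<^esub> c \<and> c \<rightarrow>\<^bsub>T\<^esub> a))"
    (is "_ \<longleftrightarrow> ?no_triangle")
proof -
  interpret digraph T using T by (simp add: tournament_def)
  have fin: "finite S" using S by (rule finite_subset) simp
  have ends: "(u, v) \<in> arcs_ends (T \<restriction> S) \<longleftrightarrow> u \<in> S \<and> v \<in> S \<and> u \<rightarrow>\<^bsub>T\<^esub> v" for u v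
    by (auto simp: arcs_ends_conv)
  have dig: "digraph (T \<restriction> S)"
    using fin no_loops no_multi_arcs by unfold_locales auto
  interpret TS: digraph "T \<restriction> S" by (rule dig)
  have tour: "tournament (T \<restriction> S)"
    using T S dig unfolding tournament_def ends by auto
  have "forest (T \<restriction> S) \<longleftrightarrow> ?no_triangle"
  proof
    assume forest: "forest (T \<restriction> S)"
    show ?no_triangle
    proof (intro ballI notI, elim conjE)
      fix a b c assume abc: "a \<in> S" "b \<in> S" "c \<in> S" "a \<rightarrow>\<^bsub>T\<^esub> b" "b \<rightarrow>\<^bsub>T\<^esub> c" "c \<rightarrow>\<^bsub>T\<^esub> a"
      then obtain e1 e2 e3 where
        "e1 \<in> arcs T" "tail T e1 = a" "head T e1 = b" "e2 \<in> arcs T" "tail T e2 = b" "head T e2 = c"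
        "e3 \<in> arcs T" "tail T e3 = c" "head T e3 = a" by (metis reachableE)
      moreover have "a \<noteq> b" "b \<noteq> c" "c \<noteq> a" using abc adj_not_same by blast+
      ultimately have "TS.cycle [e1, e2, e3]"
        unfolding TS.cycle_def TS.awalk_def using abc by (intro exI[of _ a]) auto
      then show False using forest by (auto simp: forest_def)
    qed
  next
    assume tri: ?no_triangle
    have "wf {(u, v). u \<in> S \<and> v \<in> S \<and> u \<rightarrow>\<^bsub>T\<^esub> v}"
      by (rule wf_tournament_if_no_triangle[OF fin tournament_on_subset[OF tournament_on_dominates[OF T] S]])
         (use tri in blast)
    also have "{(u, v). u \<in> S \<and> v \<in> S \<and> u \<rightarrow>\<^bsub>T\<^esub> v} = arcs_ends (T \<restriction> S)" using ends by auto
    finally have "acyclic (arcs_ends (T \<restriction> S))" by (rule wf_acyclic)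
    then show "forest (T \<restriction> S)"
      unfolding forest_def TS.cycle_def acyclic_def using TS.reachable1_awalk by blast
  qed
  with tour show ?thesis by (simp add: transitive_tournament_def)
qed

lemma locally_transitive_iff:
  assumes T: "tournament T"
  shows "locally_transitive T \<longleftrightarrow> locally_transitive_on (verts T) (\<lambda>u v. u \<rightarrow>\<^bsub>T\<^esub> v)"
proof -
  have "out_neighbors T v \<subseteq> verts T" "in_neighbors T v \<subseteq> verts T" for v
    by (auto simp: out_neighbors_def in_neighbors_def)
  note iff = this[THEN transitive_tournament_induced_iff[OF T]]
  show ?thesis
    unfolding locally_transitive_def iff locally_transitive_on_def
    by (rule ball_cong[OF refl], unfold out_neighbors_def in_neighbors_def mem_Collect_eq Ball_def,
        rule iffI) meson+
qed

theorem theorem1p4: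
  fixes T :: "('a, 'b) pre_digraph" and n :: nat
  assumes "tournament T" and "card (verts T) = n" and "n \<ge> 1"
  shows "real (allarb T) \<ge>
           1 / real n * ((\<Prod>v \<in> verts T. real (out_degree T v) + 1) +
                         (\<Prod>v \<in> verts T. real (out_degree T v))) \<and>
         (real (allarb T) =
           1 / real n * ((\<Prod>v \<in> verts T. real (out_degree T v) + 1) +
                         (\<Prod>v \<in> verts T. real (out_degree T v)))
          \<longleftrightarrow> locally_transitive T)"
proof -
  interpret digraph T using assms(1) by (simp add: tournament_def)
  define rhs where "rhs = (\<Prod>v\<in>verts T. out_degree T v + 1) + (\<Prod>v\<in>verts T. out_degree T v)"
  have V: "finite (verts T)" "verts T \<noteq> {}" using assms(2,3) by auto
  have allarb: "(\<Sum>r\<in>verts T. card (parents r)) = allarb T"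
    unfolding allarb_def by (rule sum.cong) (simp_all add: arb_eq_card_parents)
  have main: "rhs \<le> n * allarb T" "n * allarb T = rhs \<longleftrightarrow> locally_transitive T"
    using parent_maps_tournament[OF V tournament_on_dominates[OF assms(1)]]
    unfolding out_degree_eq_card_out_neighbors[symmetric] allarb assms(2)
      locally_transitive_iff[OF assms(1), symmetric] rhs_def by blast+
  have "(\<Prod>v\<in>verts T. real (out_degree T v) + 1) + (\<Prod>v\<in>verts T. real (out_degree T v)) = real rhs"
    by (simp add: rhs_def add.commute)
  moreover have "1 / real n * real rhs \<le> real (allarb T) \<longleftrightarrow> rhs \<le> n * allarb T"
    using assms(3) by (simp add: divide_simps mult.commute flip: of_nat_mult)
  moreover have "real (allarb T) = 1 / real n * real rhs \<longleftrightarrow> n * allarb T = rhs"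
    using assms(3) by (simp add: divide_simps mult.commute flip: of_nat_mult)
  ultimately show ?thesis using main by simp
qed

end
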